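(* Let $X(\mathbb{R}^n)$ be a quasi-sBfs with quasi-norm $\|\cdot\|_X$. Let $\phi:\mathbb{R}^n\times(0,\infty)\to(0,\infty)$ satisfy the following two conditions: (a) there is a constant $C>0$ such that $\phi(x,r)\le C\phi(x,s)$ for all $x\in\mathbb{R}^n$ and all $r\ge s>0$; (b) there is a constant $C\ge 1$ such that $\frac1C\le\frac{\phi(x,r)}{\phi(y,r)}\le C$ for all $x,y\in\mathbb{R}^n$ and $r>0$ with $|x-y|\le r$. Let $f\in L^1_{\rm loc}(\mathbb{R}^n)$. Then the following assertions hold: (1) If the Hardy–Littlewood maximal operator $M$ is weakly bounded on $X(\mathbb{R}^n)$, then there exists $C>0$, independent of $f$, such that $$\|f\|_{\mathcal{L}_{1,\phi}}\le C\sup_{Q\in\mathcal{Q}}\phi(Q)\frac{\|(f-f_Q)\chi_Q\|_X}{\|\chi_Q\|_X}.$$ (2) If there exist $\eta>1$ and $C>0$ such that for all sequences $\{f_j\}_{j\in\mathbb{Z}}\subset L^0(\mathbb{R}^n)$, $$\left\|\sum_{j\in\mathbb{Z}}(Mf_j)^\eta\right\|_X\le C\left\|\sum_{j\in\mathbb{Z}}|f_j|^\eta\right\|_X,$$ then there exists $C>0$, independent of $f$, such that $$\sup_{Q\in\mathcal{Q}}\phi(Q)\frac{\|(f-f_Q)\chi_Q\|_X}{\|\chi_Q\|_X}\le C\|f\|_{\mathcal{L}_{1,\phi}}.$$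
   Context: $L^0(\mathbb{R}^n)$ is the space of all measurable functions on $\mathbb{R}^n$ (identified when equal a.e.); $L^1_{\rm loc}(\mathbb{R}^n)$ is the space of functions integrable on every compact set. $\mathcal{Q}=\mathcal{Q}(\mathbb{R}^n)$ is the collection of all cubes with sides parallel to the coordinate axes, written $Q=Q(x,r)=x+[-r,r)^n$ with $x\in\mathbb{R}^n$, $r>0$, and $\phi(Q)=\phi(x,r)$. $\chi_E$ is the characteristic function of $E$, and $f_Q=\frac1{|Q|}\int_Q f(x)\,dx$. A quasi-sBfs is a quasi-Banach space $X(\mathbb{R}^n)=(X(\mathbb{R}^n),\|\cdot\|_X)$ contained in $L^0(\mathbb{R}^n)$ such that: (i) if $f\in X(\mathbb{R}^n)$ and $g\in L^0(\mathbb{R}^n)$ with $|g|\le|f|$, then $g\in X(\mathbb{R}^n)$ and $\|g\|_X\le\|f\|_X$; (iii)'' for every cube $Q\in\mathcal{Q}(\mathbb{R}^n)$, $\|\chi_Q\|_X<\infty$ (i.e. $\chi_Q\in X(\mathbb{R}^n)$). Convention: $\|g\|_X=\infty$ when $g\notin X(\mathbb{R}^n)$ (in particular when $g$ is infinite on a set of positive measure). The Hardy–Littlewood maximal operator is $Mf(x)=\sup_{Q\in\mathcal{Q}}\frac{\chi_Q(x)}{|Q|}\int_Q|f(y)|\,dy$ for $f\in L^0(\mathbb{R}^n)$. $M$ is weakly bounded on $X(\mathbb{R}^n)$ if there exists a constant $C>0$ such that $\lambda\|\chi_{\{x\in\mathbb{R}^n: Mf(x)>\lambda\}}\|_X\le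 C\|f\|_X$ for all $\lambda>0$ and all $f\in X(\mathbb{R}^n)$. The Campanato norm is $\|f\|_{\mathcal{L}_{1,\phi}}=\sup_{Q\in\mathcal{Q}}\phi(Q)\frac1{|Q|}\int_Q|f(x)-f_Q|\,dx$. All suprema may be $+\infty$. *)

theory Defs
  imports "HOL-Analysis.Analysis"
begin

text \<open>
  The functions take values in a scalar field \<open>'k\<close> of sort
  \<open>{real_normed_field, euclidean_space}\<close>, so that real-valued and complex-valued
  functions are both covered.  Elements of \<open>L\<^sup>0\<close> are represented by Lebesgue measurable
  functions; the identification of functions that are equal almost everywhere is expressed by
  requiring every space to be closed under a.e. equality, with a norm invariant under it.
\<close>

definition L0 :: "(real ^ 'n \<Rightarrow> 'k::{real_normed_field, euclidean_space}) set" where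
  "L0 = borel_measurable lebesgue"

definition L1_loc :: "(real ^ 'n \<Rightarrow> 'k::{real_normed_field, euclidean_space}) set" where
  "L1_loc = {f \<in> L0. \<forall>K. compact K \<longrightarrow> set_integrable lebesgue K f}"

definition cube :: "real ^ 'n \<Rightarrow> real \<Rightarrow> (real ^ 'n) set" where
  "cube x r = {y. \<forall>i. x $ i - r \<le> y $ i \<and> y $ i < x $ i + r}"

definition cube_avg ::
    "(real ^ 'n \<Rightarrow> 'k::{real_normed_field, euclidean_space}) \<Rightarrow> real ^ 'n \<Rightarrow> real \<Rightarrow> 'k" where
  "cube_avg f x r =
     (1 / measure lebesgue (cube x r)) *\<^sub>R (LINT y:cube x r|lebesgue. f y)"

definition quasi_Banach_in_L0 ::
    "(real ^ 'n \<Rightarrow> 'k::{real_normed_field, euclidean_space}) set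
      \<Rightarrow> ((real ^ 'n \<Rightarrow> 'k) \<Rightarrow> real) \<Rightarrow> bool" where
  "quasi_Banach_in_L0 X N \<longleftrightarrow>
     X \<subseteq> L0 \<and>
     (\<forall>f\<in>X. \<forall>g\<in>L0. (AE x in lebesgue. g x = f x) \<longrightarrow> g \<in> X \<and> N g = N f) \<and>
     (\<lambda>x. 0) \<in> X \<and>
     (\<forall>f\<in>X. \<forall>g\<in>X. (\<lambda>x. f x + g x) \<in> X) \<and>
     (\<forall>c. \<forall>f\<in>X. (\<lambda>x. c * f x) \<in> X) \<and>
     (\<forall>f\<in>X. 0 \<le> N f) \<and>
     (\<forall>f\<in>X. N f = 0 \<longleftrightarrow> (AE x in lebesgue. f x = 0)) \<and>
     (\<forall>c. \<forall>f\<in>X. N (\<lambda>x. c * f x) = norm c * N f) \<and>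
     (\<exists>K\<ge>1. \<forall>f\<in>X. \<forall>g\<in>X. N (\<lambda>x. f x + g x) \<le> K * (N f + N g)) \<and>
     (\<forall>s :: nat \<Rightarrow> real ^ 'n \<Rightarrow> 'k.
        (\<forall>k. s k \<in> X) \<longrightarrow>
        (\<forall>e>0. \<exists>M. \<forall>k\<ge>M. \<forall>m\<ge>M. N (\<lambda>x. s k x - s m x) < e) \<longrightarrow>
        (\<exists>f\<in>X. (\<lambda>k. N (\<lambda>x. s k x - f x)) \<longlonglongrightarrow> 0))"

definition quasi_sBfs ::
    "(real ^ 'n \<Rightarrow> 'k::{real_normed_field, euclidean_space}) set
      \<Rightarrow> ((real ^ 'n \<Rightarrow> 'k) \<Rightarrow> real) \<Rightarrow> bool" where
  "quasi_sBfs X N \<longleftrightarrow>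
     quasi_Banach_in_L0 X N \<and>
     (\<forall>f\<in>X. \<forall>g\<in>L0. (AE x in lebesgue. norm (g x) \<le> norm (f x)) \<longrightarrow> g \<in> X \<and> N g \<le> N f) \<and>
     (\<forall>x. \<forall>r>0. indicator (cube x r) \<in> X)"

definition ext_norm ::
    "(real ^ 'n \<Rightarrow> 'k) set \<Rightarrow> ((real ^ 'n \<Rightarrow> 'k) \<Rightarrow> real)
      \<Rightarrow> (real ^ 'n \<Rightarrow> 'k::{real_normed_field, euclidean_space}) \<Rightarrow> ennreal" where
  "ext_norm X N g = (if g \<in> X then ennreal (N g) else top)"

text \<open>
  The norm of a \<open>[0,\<infinity>]\<close>-valued function: \<open>\<infinity>\<close> if the function is infinite on a set of
  positive measure; otherwise the function agrees a.e. with the finite function below.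
\<close>

definition ext_norm_nn ::
    "(real ^ 'n \<Rightarrow> 'k::{real_normed_field, euclidean_space}) set
      \<Rightarrow> ((real ^ 'n \<Rightarrow> 'k) \<Rightarrow> real) \<Rightarrow> (real ^ 'n \<Rightarrow> ennreal) \<Rightarrow> ennreal" where
  "ext_norm_nn X N h =
     (if AE x in lebesgue. h x \<noteq> top
      then ext_norm X N (\<lambda>x. of_real (enn2real (h x))) else top)"

definition HL_maximal ::
    "(real ^ 'n \<Rightarrow> 'k::{real_normed_field, euclidean_space}) \<Rightarrow> real ^ 'n \<Rightarrow> ennreal" where
  "HL_maximal f x =
     (SUP (z, r) \<in> UNIV \<times> {0<..}.
        indicator (cube z r) x / emeasure lebesgue (cube z r)
          * (\<integral>\<^sup>+y\<in>cube z r. ennreal (norm (f y)) \<partial>lebesgue))"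

definition M_weakly_bounded ::
    "(real ^ 'n \<Rightarrow> 'k::{real_normed_field, euclidean_space}) set
      \<Rightarrow> ((real ^ 'n \<Rightarrow> 'k) \<Rightarrow> real) \<Rightarrow> bool" where
  "M_weakly_bounded X N \<longleftrightarrow>
     (\<exists>C>0. \<forall>l>0. \<forall>f\<in>X.
        ennreal l * ext_norm X N (indicator {x. HL_maximal f x > ennreal l})
          \<le> ennreal C * ext_norm X N f)"

definition enn_powr :: "ennreal \<Rightarrow> real \<Rightarrow> ennreal" where
  "enn_powr a p = (if a = top then top else ennreal (enn2real a powr p))"

definition M_vector_bounded ::
    "(real ^ 'n \<Rightarrow> 'k::{real_normed_field, euclidean_space}) set
      \<Rightarrow> ((real ^ 'n \<Rightarrow> 'k) \<Rightarrow> real) \<Rightarrow> real \<Rightarrow> real \<Rightarrow> bool" where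
  "M_vector_bounded X N \<eta> C \<longleftrightarrow>
     (\<forall>f :: int \<Rightarrow> real ^ 'n \<Rightarrow> 'k. (\<forall>j. f j \<in> L0) \<longrightarrow>
        ext_norm_nn X N (\<lambda>x. \<Sum>\<^sub>\<infinity>j\<in>UNIV. enn_powr (HL_maximal (f j) x) \<eta>)
          \<le> ennreal C * ext_norm_nn X N (\<lambda>x. \<Sum>\<^sub>\<infinity>j\<in>UNIV. enn_powr (ennreal (norm (f j x))) \<eta>))"

definition campanato_norm ::
    "(real ^ 'n \<Rightarrow> real \<Rightarrow> real)
      \<Rightarrow> (real ^ 'n \<Rightarrow> 'k::{real_normed_field, euclidean_space}) \<Rightarrow> ennreal" where
  "campanato_norm \<phi> f =
     (SUP (x, r) \<in> UNIV \<times> {0<..}.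
        ennreal (\<phi> x r) * (1 / emeasure lebesgue (cube x r))
          * (\<integral>\<^sup>+y\<in>cube x r. ennreal (norm (f y - cube_avg f x r)) \<partial>lebesgue))"

definition campanato_norm_X ::
    "(real ^ 'n \<Rightarrow> 'k::{real_normed_field, euclidean_space}) set
      \<Rightarrow> ((real ^ 'n \<Rightarrow> 'k) \<Rightarrow> real)
      \<Rightarrow> (real ^ 'n \<Rightarrow> real \<Rightarrow> real) \<Rightarrow> (real ^ 'n \<Rightarrow> 'k) \<Rightarrow> ennreal" where
  "campanato_norm_X X N \<phi> f =
     (SUP (x, r) \<in> UNIV \<times> {0<..}.
        ennreal (\<phi> x r)
          * (ext_norm X N (\<lambda>y. (f y - cube_avg f x r) * indicator (cube x r) y)
             / ext_norm X N (indicator (cube x r))))"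

end

theory Submission
  imports Defs
begin

text \<open>
  Fix a cube \<open>Q\<close>. For the first inequality, the maximal function of \<open>(f - f\<^sub>Q) \<chi>\<^sub>Q\<close> dominates the mean
  oscillation of \<open>f\<close> over \<open>Q\<close> at every point of \<open>Q\<close>, so that the weak type estimate bounds this
  oscillation by the quotient of norms (\<open>campanato_le_of_M_weakly_bounded\<close>).

  The second inequality is a John--Nirenberg type self-improvement. The usual proof dominates
  \<open>\<bar>f - f\<^sub>Q\<bar> \<chi>\<^sub>Q\<close> by a sparse sum of oscillations over cubes from iterated Calderon--Zygmund
  decompositions. There is a shorter route without stopping cubes. Let \<open>B\<close> bound the mean oscillations
  of \<open>f\<close> over the relevant subcubes, put \<open>g = \<bar>f - f\<^sub>Q\<bar> / B\<close>, and slice \<open>Q\<close> into the sets \<open>F j\<close> where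
  \<open>g\<close> is within a fixed distance \<open>K\<close> of the natural number \<open>j\<close>. As the cubes shrink from \<open>Q\<close> to a
  point \<open>x\<close>, the deviation of the average of \<open>f\<close> from \<open>f\<^sub>Q\<close>, divided by \<open>B\<close>, moves from \<open>0\<close> up to about
  \<open>g x\<close> in bounded steps. On the way it passes near every \<open>j \<le> g x\<close>. A cube where it does so is filled
  by \<open>F j\<close> to at least one half, as \<open>g\<close> is mostly close to that value there. Hence the maximal function
  of \<open>\<chi>\<close> of \<open>F j\<close> is at least \<open>1/2\<close> at \<open>x\<close> for all \<open>j \<le> g x\<close> (\<open>AE_level_set_dense_on_cube\<close>), and so
  \<open>g \<le> 2\<^sup>\<eta> * (\<Sum>j. (M \<chi>\<^bsub>F j\<^esub>)\<^sup>\<eta>)\<close> almost everywhere on \<open>Q\<close>. The slices overlap boundedly, so the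
  vector-valued inequality bounds the norm of this sum by a multiple of the norm of \<open>\<chi>\<^sub>Q\<close>
  (\<open>norm_oscillation_le_of_M_vector_bounded\<close>).

  Two auxiliary facts enter. That the averages come near \<open>j\<close> at all is a density statement; instead of
  Lebesgue's differentiation theorem it only needs that a set is null if around each of its points it
  fills at most a fraction \<open>c < 1\<close> of arbitrarily small balls (\<open>negligible_if_density_less_one\<close>). That one \<open>B\<close>
  proportional to \<open>1 / \<phi> Q\<close> serves all subcubes follows from the two conditions on \<open>\<phi>\<close>
  (\<open>doubling_weight_chain\<close>).
\<close>

section \<open>A density criterion for null sets\<close>

text \<open>
  Every open cover of \<open>S\<close> of finite measure can be shrunk by a factor below one, so the outer measure
  of \<open>S\<close> is zero. The shrinking comes from Vitali's theorem: inside an open cover \<open>V\<close> of \<open>S\<close>,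
  disjoint balls exhaust \<open>S\<close> up to a null set, and in each of them \<open>S\<close> fits into at most the
  fraction \<open>c\<close>. This is a sharpening of one direction of \<open>negligible_eq_zero_density\<close>, where the density
  has to be arbitrarily small; it replaces Lebesgue's density theorem below.
\<close>

lemma negligible_if_density_less_one:
  fixes S :: "'a::euclidean_space set"
  assumes "bounded S" "c < 1"
    and dens: "\<And>x e. x \<in> S \<Longrightarrow> e > 0 \<Longrightarrow> \<exists>d U. 0 < d \<and> d < e \<and> S \<inter> cball x d \<subseteq> U \<and>
        U \<in> lmeasurable \<and> measure lebesgue U \<le> c * measure lebesgue (cball x d)"
  shows "negligible S"
proof (cases "S = {}")
  case False
  have "c \<ge> 0"
  proof -
    obtain x where "x \<in> S" using False by blast
    then obtain d and U :: "'a set" where "0 < d" "measure lebesgue U \<le> c * measure lebesgue (cball x d)"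
      using dens[of x 1] by (metis zero_less_one)
    have "0 \<le> c * measure lebesgue (cball x d)"
      by (rule order_trans[OF measure_nonneg \<open>measure lebesgue U \<le> _\<close>])
    moreover have "measure lebesgue (cball x d) > 0"
      using content_cball_pos[OF \<open>0 < d\<close>, of x] by simp
    ultimately show ?thesis
      using mult_neg_pos[of c "measure lebesgue (cball x d)"] by linarith
  qed
  have step: "\<exists>W. W \<in> lmeasurable \<and> S \<subseteq> W \<and> measure lebesgue W \<le> c * measure lebesgue V"
    if V: "open V" "V \<in> lmeasurable" "S \<subseteq> V" for V
  proof -
    \<comment> \<open>\<open>P i U\<close>: the ball with centre and radius \<open>i\<close> is admissible, witnessed by \<open>U\<close>. Such balls form a
      fine cover of \<open>S\<close>, so countably many disjoint ones cover \<open>S\<close> up to a null set.\<close>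
    define P where "P i U \<longleftrightarrow> 0 < snd i \<and> cball (fst i) (snd i) \<subseteq> V \<and> S \<inter> cball (fst i) (snd i) \<subseteq> U \<and>
        U \<subseteq> cball (fst i) (snd i) \<and> U \<in> lmeasurable \<and>
        measure lebesgue U \<le> c * measure lebesgue (cball (fst i) (snd i))" for i :: "'a \<times> real" and U
    define K where "K = {i. \<exists>U. P i U}"
    define U where "U i = (SOME U. P i U)" for i
    have U: "P i (U i)" if "i \<in> K" for i
      using that unfolding K_def U_def by (auto intro: someI_ex)
    have cov: "\<exists>i. i \<in> K \<and> x \<in> cball (fst i) (snd i) \<and> snd i < e" if "x \<in> S" "e > 0" for x e
    proof -
      obtain r where r: "r > 0" "cball x r \<subseteq> V"
        using V \<open>x \<in> S\<close> by (meson open_contains_cball subsetD)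
      obtain d T where d: "0 < d" "d < min e r" "S \<inter> cball x d \<subseteq> T" "T \<in> lmeasurable"
          "measure lebesgue T \<le> c * measure lebesgue (cball x d)"
        using dens[OF \<open>x \<in> S\<close>, of "min e r"] \<open>e > 0\<close> \<open>r > 0\<close> by auto
      have "measure lebesgue (T \<inter> cball x d) \<le> measure lebesgue T"
        using d by (intro measure_mono_fmeasurable) auto
      then have "measure lebesgue (T \<inter> cball x d) \<le> c * measure lebesgue (cball x d)"
        using d by linarith
      moreover have "cball x d \<subseteq> V"
        using d r by (intro order_trans[OF subset_cball r(2)]) auto
      moreover have "T \<inter> cball x d \<in> lmeasurable"
        using d by (intro fmeasurable.Int) auto
      ultimately have "P (x, d) (T \<inter> cball x d)"
        using d by (auto simp: P_def)
      then show ?thesis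
        using d by (intro exI[of _ "(x, d)"]) (auto simp: K_def)
    qed
    have pos: "\<And>i. i \<in> K \<Longrightarrow> 0 < snd i"
      using U unfolding P_def by blast
    obtain C where C: "countable C" "C \<subseteq> K"
      "pairwise (\<lambda>i j. disjnt (cball (fst i) (snd i)) (cball (fst j) (snd j))) C"
      "negligible (S - (\<Union>i\<in>C. cball (fst i) (snd i)))"
      using Vitali_covering_theorem_cballs[of K snd S fst, OF pos cov] by blast
    let ?B = "\<lambda>i. cball (fst i) (snd i)"
    have UC: "U i \<subseteq> ?B i" "S \<inter> ?B i \<subseteq> U i" "?B i \<subseteq> V" "U i \<in> lmeasurable"
        "measure lebesgue (U i) \<le> c * measure lebesgue (?B i)" if "i \<in> C" for i
      using U[OF subsetD[OF C(2) that]] unfolding P_def by blast+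
    have djB: "disjoint_family_on ?B C"
      using C(3) by (auto simp: disjoint_family_on_def pairwise_def disjnt_def)
    then have djU: "disjoint_family_on U C"
      using UC(1) unfolding disjoint_family_on_def by blast
    have le: "emeasure lebesgue (U i) \<le> ennreal c * emeasure lebesgue (?B i)" if "i \<in> C" for i
      using UC(4,5)[OF that] \<open>c \<ge> 0\<close>
      by (simp add: emeasure_eq_measure2 ennreal_mult'[symmetric] ennreal_leI)
    have "emeasure lebesgue (\<Union>i\<in>C. U i) = (\<integral>\<^sup>+i. emeasure lebesgue (U i) \<partial>count_space C)"
      using UC C djU by (intro emeasure_UN_countable) (auto simp: fmeasurableD)
    also have "\<dots> \<le> (\<integral>\<^sup>+i. ennreal c * emeasure lebesgue (?B i) \<partial>count_space C)"
      using le by (intro nn_integral_mono) auto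
    also have "\<dots> = ennreal c * (\<integral>\<^sup>+i. emeasure lebesgue (?B i) \<partial>count_space C)"
      by (intro nn_integral_cmult) auto
    also have "(\<integral>\<^sup>+i. emeasure lebesgue (?B i) \<partial>count_space C) = emeasure lebesgue (\<Union>i\<in>C. ?B i)"
      using C djB by (intro emeasure_UN_countable[symmetric]) auto
    also have "\<dots> \<le> emeasure lebesgue V"
      using UC(3) V by (intro emeasure_mono) (auto simp: fmeasurableD)
    finally have em: "emeasure lebesgue (\<Union>i\<in>C. U i) \<le> ennreal c * emeasure lebesgue V"
      by (simp add: mult_left_mono)
    let ?N = "S - (\<Union>i\<in>C. ?B i)"
    have Um: "(\<Union>i\<in>C. U i) \<in> lmeasurable"
    proof (rule fmeasurableI)
      show "(\<Union>i\<in>C. U i) \<in> sets lebesgue"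
        using C UC by (intro sets.countable_UN') (auto simp: fmeasurableD)
      show "emeasure lebesgue (\<Union>i\<in>C. U i) < \<infinity>"
        using em V by (simp add: emeasure_eq_measure2 ennreal_mult_less_top order_le_less_trans)
    qed
    have ms: "measure lebesgue (\<Union>i\<in>C. U i) \<le> c * measure lebesgue V"
      using em Um V \<open>c \<ge> 0\<close> by (simp add: emeasure_eq_measure2 flip: ennreal_mult')
    have Nn: "?N \<in> null_sets lebesgue"
      using C(4) negligible_iff_null_sets by blast
    show ?thesis
    proof (intro exI conjI)
      show "(\<Union>i\<in>C. U i) \<union> ?N \<in> lmeasurable"
        using Um C(4) by (simp add: fmeasurable.Un negligible_imp_measurable)
      show "S \<subseteq> (\<Union>i\<in>C. U i) \<union> ?N" using UC(2) by blast
      show "measure lebesgue ((\<Union>i\<in>C. U i) \<union> ?N) \<le> c * measure lebesgue V"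
        using ms Nn Um by (simp add: measure_Un_null_set fmeasurableD)
    qed
  qed
  \<comment> \<open>\<open>m\<close> is the outer measure of \<open>S\<close>\<close>
  define M where "M = {measure lebesgue V |V. V \<in> lmeasurable \<and> S \<subseteq> V}"
  define m where "m = Inf M"
  have bdd: "bdd_below M" unfolding M_def by (auto intro: bdd_belowI[of _ 0])
  obtain a b where "S \<subseteq> cbox a b" using \<open>bounded S\<close> bounded_subset_cbox_symmetric by blast
  then have ne: "M \<noteq> {}" unfolding M_def using lmeasurable_cbox by blast
  have "m \<ge> 0" unfolding m_def using ne by (intro cInf_greatest) (auto simp: M_def)
  have outer: "m \<le> c * (v + e)" if v: "v \<in> M" and "e > 0" for v e
  proof -
    obtain V where V: "V \<in> lmeasurable" "S \<subseteq> V" "v = measure lebesgue V"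
      using v by (auto simp: M_def)
    obtain T where T: "open T" "V \<subseteq> T" "T - V \<in> lmeasurable" "emeasure lebesgue (T - V) < ennreal e"
      using sets_lebesgue_outer_open[of V e] V \<open>e > 0\<close> by (auto simp: fmeasurableD)
    have TV: "T = V \<union> (T - V)" using T by auto
    have Tm: "T \<in> lmeasurable" using V T TV by (metis fmeasurable.Un)
    have "measure lebesgue (T - V) < e"
      using T(3,4) \<open>e > 0\<close> by (simp add: emeasure_eq_measure2 ennreal_less_iff)
    then have mT: "measure lebesgue T \<le> v + e"
      using measure_Un_le[of V lebesgue "T - V"] V T TV by (auto simp: fmeasurableD)
    obtain W where W: "W \<in> lmeasurable" "S \<subseteq> W" "measure lebesgue W \<le> c * measure lebesgue T"
      using step[OF T(1) Tm] V T by auto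
    have "m \<le> measure lebesgue W"
      unfolding m_def using W bdd by (intro cInf_lower) (auto simp: M_def)
    also have "\<dots> \<le> c * (v + e)"
      using W mT \<open>c \<ge> 0\<close> by (meson mult_left_mono order_trans)
    finally show ?thesis .
  qed
  have contr: "m \<le> c * (m + e)" if "e > 0" for e
  proof -
    obtain v where "v \<in> M" "v < m + e/2"
      using cInf_lessD[OF ne, of "m + e/2"] \<open>e > 0\<close> unfolding m_def by auto
    then have "m \<le> c * (v + e/2)" "c * (v + e/2) \<le> c * (m + e)"
      using outer[of v "e/2"] that \<open>c \<ge> 0\<close> by (auto intro!: mult_left_mono)
    then show ?thesis by simp
  qed
  have "m \<le> 0"
  proof (rule ccontr)
    assume "\<not> m \<le> 0"
    then have "m > 0" by simp
    define e where "e = m * (1 - c) / 2"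
    have "e > 0" using \<open>m > 0\<close> \<open>c < 1\<close> by (simp add: e_def)
    have "c * e \<le> e" using \<open>c < 1\<close> \<open>e > 0\<close> by simp
    then have "m \<le> c * m + e" using contr[OF \<open>e > 0\<close>] by (simp add: algebra_simps)
    then have "m * (1 - c) \<le> 0" by (simp add: e_def field_simps)
    then show False using \<open>m > 0\<close> \<open>c < 1\<close> by (simp add: mult_le_0_iff)
  qed
  have "\<exists>v\<in>M. v < e" if "e > 0" for e
    using cInf_lessD[OF ne, of e] \<open>m \<le> 0\<close> that unfolding m_def by auto
  then show ?thesis
    unfolding negligible_outer M_def by blast
qed auto

section \<open>Cubes, averages and oscillations\<close>

lemma box_subset_cube:
  "box (\<chi> i. x $ i - r) (\<chi> i. x $ i + r) \<subseteq> cube x r"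
  by (auto simp: cube_def mem_box_cart less_imp_le)

lemma cube_subset_cbox:
  "cube x r \<subseteq> cbox (\<chi> i. x $ i - r) (\<chi> i. x $ i + r)"
  by (auto simp: cube_def mem_box_cart less_imp_le)

lemma sets_cube [measurable]: "cube x r \<in> sets borel"
proof -
  have "cube x r = (\<Inter>i. {y. x $ i - r \<le> y $ i} \<inter> {y. y $ i < x $ i + r})"
    by (auto simp: cube_def)
  also have "\<dots> \<in> sets borel"
    using closed_halfspace_component_ge_cart open_halfspace_component_lt_cart
    by (intro sets.countable_INT'' sets.Int borel_closed borel_open)
      (auto simp: closed_halfspace_component_ge_cart open_halfspace_component_lt_cart)
  finally show ?thesis .
qed

lemma lmeasurable_cube [simp]: "cube x r \<in> lmeasurable"
  using sets_cube bounded_subset[OF bounded_cbox cube_subset_cbox]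
  by (intro bounded_set_imp_lmeasurable) auto

lemma sets_lebesgue_cube [measurable, simp]: "cube x r \<in> sets lebesgue"
  using lmeasurable_cube by (rule fmeasurableD)

lemma measure_cube:
  fixes x :: "real ^ 'n"
  assumes "r > 0"
  shows "measure lebesgue (cube x r) = (2 * r) ^ CARD('n)"
proof (rule antisym)
  let ?a = "(\<chi> i. x $ i - r) :: real ^ 'n" and ?b = "(\<chi> i. x $ i + r) :: real ^ 'n"
  have ne: "cbox ?a ?b \<noteq> {}"
    using assms by (auto simp: interval_ne_empty_cart)
  have c: "measure lebesgue (cbox ?a ?b) = (2 * r) ^ CARD('n)"
    using content_cbox_cart[OF ne] by simp
  show "measure lebesgue (cube x r) \<le> (2 * r) ^ CARD('n)"
    using measure_mono_fmeasurable[OF cube_subset_cbox, of x r lebesgue] c by simp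
  have "measure lebesgue (box ?a ?b) \<le> measure lebesgue (cube x r)"
    by (intro measure_mono_fmeasurable[OF box_subset_cube]) auto
  moreover have "measure lebesgue (box ?a ?b) = measure lebesgue (cbox ?a ?b)"
    by (simp add: measure_lborel_box_eq measure_lborel_cbox_eq)
  ultimately show "(2 * r) ^ CARD('n) \<le> measure lebesgue (cube x r)"
    using c by simp
qed

lemma measure_cube_pos: "r > 0 \<Longrightarrow> 0 < measure lebesgue (cube x r)"
  by (subst measure_cube) auto

lemma emeasure_cube:
  "emeasure lebesgue (cube x r) = ennreal (measure lebesgue (cube x r))"
  by (simp add: emeasure_eq_measure2)

lemma norm_le_of_mem_cube:
  fixes x y :: "real ^ 'n" and r :: real
  assumes "y \<in> cube x r"
  shows "norm (y - x) \<le> real CARD('n) * r"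
proof -
  have "norm (y - x) \<le> (\<Sum>i\<in>UNIV. \<bar>(y - x) $ i\<bar>)" by (rule norm_le_l1_cart)
  also have "\<dots> \<le> (\<Sum>i\<in>(UNIV::'n set). r)"
    using assms by (intro sum_mono) (auto simp: cube_def abs_le_iff algebra_simps less_imp_le)
  finally show ?thesis by simp
qed

text \<open>
  The cube in question is the image of \<open>cube c r\<close> under the homothety with centre \<open>x\<close> and ratio \<open>t\<close>.
  Shrinking towards \<open>x\<close> in this way keeps the cubes inside the original one and keeps \<open>x\<close> in all of
  them, even when \<open>x\<close> lies on the boundary. The price is that \<open>x\<close> is not their centre.
\<close>

lemma homothetic_cube:
  fixes x c :: "real ^ 'n" and r t :: real
  assumes "x \<in> cube c r" "0 < t" "t \<le> 1"
  shows "x \<in> cube (x + t *\<^sub>R (c - x)) (t * r)"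
    and "cube (x + t *\<^sub>R (c - x)) (t * r) \<subseteq> cube c r"
    and "cube (x + t *\<^sub>R (c - x)) (t * r) \<subseteq> cball x (2 * t * r * real CARD('n))"
    and "norm (x + t *\<^sub>R (c - x) - c) \<le> real CARD('n) * r"
proof -
  have x: "c $ i - r \<le> x $ i" "x $ i < c $ i + r" for i
    using assms by (auto simp: cube_def)
  have r: "r > 0" using x[of undefined] by simp
  show xin: "x \<in> cube (x + t *\<^sub>R (c - x)) (t * r)"
  proof -
    have "t * (c $ i - r) \<le> t * x $ i" "t * x $ i < t * (c $ i + r)" for i
      using x[of i] \<open>0 < t\<close> by auto
    then show ?thesis by (auto simp: cube_def algebra_simps)
  qed
  show "cube (x + t *\<^sub>R (c - x)) (t * r) \<subseteq> cube c r"
  proof -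
    have "(1 - t) * (c $ i - r) \<le> (1 - t) * x $ i" "(1 - t) * x $ i \<le> (1 - t) * (c $ i + r)" for i
      using x[of i] \<open>t \<le> 1\<close> by (auto intro!: mult_left_mono)
    then have "c $ i - r \<le> x $ i + t * (c $ i - x $ i) - t * r"
      "x $ i + t * (c $ i - x $ i) + t * r \<le> c $ i + r" for i
      by (auto simp: algebra_simps)
    then show ?thesis by (auto simp: cube_def intro: order_trans less_le_trans)
  qed
  have n1: "norm (x - c) \<le> real CARD('n) * r"
    using norm_le_of_mem_cube[OF assms(1)] .
  have n2: "norm (x + t *\<^sub>R (c - x) - x) \<le> real CARD('n) * (t * r)"
    using norm_le_of_mem_cube[OF xin] by (simp add: norm_minus_commute)
  show "norm (x + t *\<^sub>R (c - x) - c) \<le> real CARD('n) * r"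
  proof -
    have "x + t *\<^sub>R (c - x) - c = (1 - t) *\<^sub>R (x - c)" by (simp add: algebra_simps)
    then have "norm (x + t *\<^sub>R (c - x) - c) = (1 - t) * norm (x - c)" using assms by simp
    also have "\<dots> \<le> 1 * norm (x - c)" using assms by (intro mult_right_mono) auto
    finally show ?thesis using n1 by simp
  qed
  show "cube (x + t *\<^sub>R (c - x)) (t * r) \<subseteq> cball x (2 * t * r * real CARD('n))"
  proof
    fix y assume "y \<in> cube (x + t *\<^sub>R (c - x)) (t * r)"
    then have "norm (y - (x + t *\<^sub>R (c - x))) \<le> real CARD('n) * (t * r)"
      by (rule norm_le_of_mem_cube)
    then have "norm (y - x) \<le> real CARD('n) * (t * r) + real CARD('n) * (t * r)"
      using n2 by (rule norm_diff_triangle_le)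
    then show "y \<in> cball x (2 * t * r * real CARD('n))"
      by (simp add: dist_norm norm_minus_commute mult_ac)
  qed
qed

lemma set_integrable_cube:
  assumes "f \<in> L1_loc"
  shows "set_integrable lebesgue (cube x r) f"
  using assms unfolding L1_loc_def
  by (auto intro!: set_integrable_subset[OF _ _ cube_subset_cbox])

lemma set_integrable_cube_norm_diff:
  assumes "f \<in> L1_loc"
  shows "set_integrable lebesgue (cube x r) (\<lambda>y. f y - a)"
    and "set_integrable lebesgue (cube x r) (\<lambda>y. norm (f y - a))"
proof -
  have "set_integrable lebesgue (cube x r) (\<lambda>y. a)"
    using lmeasurable_cube[of x r] by (simp add: set_integrable_def fmeasurable_def)
  then show *: "set_integrable lebesgue (cube x r) (\<lambda>y. f y - a)"
    using set_integrable_cube[OF assms] by (intro set_integral_diff)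
  show "set_integrable lebesgue (cube x r) (\<lambda>y. norm (f y - a))"
    using set_integrable_norm[OF *] .
qed

lemma nn_integral_cube_norm_diff:
  assumes "f \<in> L1_loc"
  shows "(\<integral>\<^sup>+y\<in>cube x r. ennreal (norm (f y - a)) \<partial>lebesgue) =
    ennreal (LINT y:cube x r|lebesgue. norm (f y - a))"
proof -
  have "(\<integral>\<^sup>+y\<in>cube x r. ennreal (norm (f y - a)) \<partial>lebesgue) =
      (\<integral>\<^sup>+y. ennreal (indicator (cube x r) y *\<^sub>R norm (f y - a)) \<partial>lebesgue)"
    by (intro nn_integral_cong) (auto simp: indicator_def)
  also have "\<dots> = ennreal (LINT y:cube x r|lebesgue. norm (f y - a))"
    unfolding set_lebesgue_integral_def
    using set_integrable_cube_norm_diff(2)[OF assms, of x r a]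
    by (intro nn_integral_eq_integral) (auto simp: set_integrable_def)
  finally show ?thesis .
qed

text \<open>
  Averages over comparable nested cubes differ by at most a multiple of the mean oscillation:
  bounding the integral over the small cube by the one over the large cube costs the ratio of volumes.
\<close>

lemma norm_cube_avg_diff_le:
  fixes f :: "real ^ 'n \<Rightarrow> 'k::{real_normed_field, euclidean_space}"
  assumes f: "f \<in> L1_loc" and s: "s' > 0" "cube z' s' \<subseteq> cube z s"
  shows "norm (cube_avg f z' s' - a) \<le>
    (LINT y:cube z s|lebesgue. norm (f y - a)) / measure lebesgue (cube z' s')"
proof -
  let ?m = "measure lebesgue (cube z' s')"
  have m: "?m > 0" using s by (intro measure_cube_pos)
  have i: "set_integrable lebesgue (cube z' s') (\<lambda>y. a)"
    using lmeasurable_cube[of z' s'] by (simp add: set_integrable_def fmeasurable_def)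
  have "(LINT y:cube z' s'|lebesgue. f y - a) =
      (LINT y:cube z' s'|lebesgue. f y) - (LINT y:cube z' s'|lebesgue. a)"
    by (intro set_integral_diff set_integrable_cube f i)
  also have "(LINT y:cube z' s'|lebesgue. a) = ?m *\<^sub>R a"
    using lmeasurable_cube[of z' s']
    by (simp add: set_lebesgue_integral_def fmeasurable_def)
  finally have "cube_avg f z' s' - a = (1 / ?m) *\<^sub>R (LINT y:cube z' s'|lebesgue. f y - a)"
    using m by (simp add: cube_avg_def scaleR_diff_right)
  then have "norm (cube_avg f z' s' - a) = norm (LINT y:cube z' s'|lebesgue. f y - a) / ?m"
    using m by simp
  also have "\<dots> \<le> (LINT y:cube z' s'|lebesgue. norm (f y - a)) / ?m"
    using m set_integral_norm_bound[OF set_integrable_cube_norm_diff(1)[OF f]]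
    by (intro divide_right_mono) auto
  also have "\<dots> \<le> (LINT y:cube z s|lebesgue. norm (f y - a)) / ?m"
    using m s set_integrable_cube_norm_diff(2)[OF f]
    unfolding set_lebesgue_integral_def set_integrable_def
    by (intro divide_right_mono integral_mono) (auto simp: indicator_def)
  finally show ?thesis .
qed

text \<open>Chebyshev's inequality, with the threshold at which at least half of the cube remains.\<close>

lemma measure_large_deviation_le:
  fixes f :: "real ^ 'n \<Rightarrow> 'k::{real_normed_field, euclidean_space}"
  assumes f: "f \<in> L1_loc" and "B > 0"
    and osc: "(LINT y:cube z s|lebesgue. norm (f y - a)) \<le> B * measure lebesgue (cube z s)"
  shows "measure lebesgue {y \<in> cube z s. norm (f y - a) \<ge> 2 * B} \<le> measure lebesgue (cube z s) / 2"
proof -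
  let ?u = "\<lambda>y. indicator (cube z s) y *\<^sub>R norm (f y - a)"
  have i: "integrable lebesgue ?u"
    using set_integrable_cube_norm_diff(2)[OF f, of z s a] by (simp add: set_integrable_def)
  have "{y \<in> cube z s. norm (f y - a) \<ge> 2 * B} = {y \<in> space lebesgue. ?u y \<ge> 2 * B}"
    using \<open>B > 0\<close> by (auto simp: indicator_def split: if_splits)
  then have "measure lebesgue {y \<in> cube z s. norm (f y - a) \<ge> 2 * B} \<le> (\<integral>y. ?u y \<partial>lebesgue) / (2 * B)"
    using integral_Markov_inequality_measure[OF i sets.empty_sets, of "2 * B"] \<open>B > 0\<close> by simp
  also have "\<dots> \<le> measure lebesgue (cube z s) / 2"
    using osc \<open>B > 0\<close> by (simp add: set_lebesgue_integral_def field_simps)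
  finally show ?thesis .
qed

section \<open>Level sets of the deviation from the average\<close>

text \<open>
  This is the heart of the second part. Let \<open>g\<close> be the normalised deviation of \<open>f\<close> from its average
  over \<open>Q = cube c r\<close> and shrink \<open>Q\<close> towards \<open>x\<close> by powers of \<open>1/2\<close>. The normalised deviation of the
  averages over the shrunken cubes from that over \<open>Q\<close> is a sequence \<open>a x k\<close> which starts at \<open>0\<close> and
  whose steps are at most \<open>2 ^ n\<close>. If it ever reaches \<open>j - 2\<close>, then at the first such moment it is
  within \<open>2 + 2 ^ n\<close> of \<open>j\<close>, and \<open>g\<close> is within \<open>2\<close> of \<open>a x k\<close> on half of that cube by Chebyshev.
  If it never does although \<open>g x \<ge> j\<close>, then the set \<open>{g \<ge> j}\<close> occupies at most half of every
  shrunken cube, and such \<open>x\<close> form a null set by \<open>negligible_if_density_less_one\<close>.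
\<close>

lemma AE_level_set_dense_on_cube:
  fixes f :: "real ^ 'n \<Rightarrow> 'k::{real_normed_field, euclidean_space}" and c :: "real ^ 'n"
  assumes f: "f \<in> L1_loc" and r: "r > 0" and B: "B > 0"
    and osc: "\<And>z s. 0 < s \<Longrightarrow> s \<le> r \<Longrightarrow> norm (z - c) \<le> real CARD('n) * r \<Longrightarrow>
      (LINT y:cube z s|lebesgue. norm (f y - cube_avg f z s)) \<le> B * measure lebesgue (cube z s)"
  defines "g \<equiv> (\<lambda>y. norm (f y - cube_avg f c r) / B)"
  shows "AE x in lebesgue. x \<in> cube c r \<longrightarrow> (\<forall>j::nat. real j \<le> g x \<longrightarrow>
    (\<exists>z s. s > 0 \<and> x \<in> cube z s \<and> measure lebesgue (cube z s) / 2 \<le>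
      measure lebesgue (cube z s \<inter> {y \<in> cube c r. \<bar>g y - real j\<bar> \<le> 4 + 2 ^ CARD('n)})))"
proof -
  let ?n = "CARD('n)"
  let ?Q = "cube c r"
  define s where "s k = (1/2) ^ k * r" for k :: nat
  define z where "z x k = x + (1/2) ^ k *\<^sub>R (c - x)" for x :: "real ^ 'n" and k :: nat
  define R where "R x k = cube (z x k) (s k)" for x k
  define a where "a x k = norm (cube_avg f (z x k) (s k) - cube_avg f c r) / B" for x k
  have s_pos: "s k > 0" for k using r by (simp add: s_def)
  have mR: "measure lebesgue (R x k) = (2 * s k) ^ ?n" for x k
    unfolding R_def by (rule measure_cube[OF s_pos])
  have Rl: "R x k \<in> lmeasurable" for x k by (simp add: R_def)
  have pow: "0 < (1/2::real) ^ k" "(1/2::real) ^ k \<le> 1" for k by (auto simp: power_le_one)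
  have s_le: "s k \<le> r" for k using pow[of k] r by (simp add: s_def mult_le_cancel_right1)
  have R: "x \<in> R x k" "R x k \<subseteq> ?Q" "R x k \<subseteq> cball x (2 * s k * real ?n)"
    "norm (z x k - c) \<le> real ?n * r" if "x \<in> ?Q" for x k
    using homothetic_cube[OF that pow[of k]] unfolding R_def z_def s_def by (auto simp: mult_ac)
  have oscR: "(LINT y:R x k|lebesgue. norm (f y - cube_avg f (z x k) (s k))) \<le> B * measure lebesgue (R x k)"
    if "x \<in> ?Q" for x k
    using osc[OF s_pos s_le] R(4)[OF that] unfolding R_def by blast
  have half: "measure lebesgue {y \<in> R x k. norm (f y - cube_avg f (z x k) (s k)) \<ge> 2 * B}
      \<le> measure lebesgue (R x k) / 2" if "x \<in> ?Q" for x k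
    using measure_large_deviation_le[OF f B] oscR[OF that] unfolding R_def by blast
  have fm [measurable]: "f \<in> borel_measurable lebesgue"
    using f by (simp add: L1_loc_def L0_def)
  have gm [measurable]: "g \<in> borel_measurable lebesgue"
    unfolding g_def by measurable
  have gB: "norm (f y - cube_avg f c r) = B * g y" for y
    using B by (simp add: g_def)
  have aB: "norm (cube_avg f (z x k) (s k) - cube_avg f c r) = B * a x k" for x k
    using B by (simp add: a_def)
  have ga: "B * \<bar>g y - a x k\<bar> \<le> norm (f y - cube_avg f (z x k) (s k))" for x y k
  proof -
    have "B * \<bar>g y - a x k\<bar> = \<bar>B * g y - B * a x k\<bar>"
      using B by (simp add: abs_mult flip: right_diff_distrib)
    also have "\<dots> \<le> norm ((f y - cube_avg f c r) - (cube_avg f (z x k) (s k) - cube_avg f c r))"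
      unfolding gB[symmetric] aB[symmetric] by (rule norm_triangle_ineq3)
    finally show ?thesis by simp
  qed
  \<comment> \<open>the exceptional points, at which the averages never come near \<open>j\<close>\<close>
  define S where "S j = {x \<in> ?Q. real j \<le> g x \<and> (\<forall>k. a x k < real j - 2)}" for j :: nat
  have negl: "negligible (S j)" for j
  proof -
    \<comment> \<open>the ratio of the volume of a shrunken cube to that of the ball around \<open>x\<close> containing it\<close>
    define \<kappa> where "\<kappa> = 1 / (real ?n ^ ?n * unit_ball_vol (real ?n))"
    have \<kappa>: "\<kappa> > 0" by (simp add: \<kappa>_def unit_ball_vol_pos)
    show ?thesis
    proof (rule negligible_if_density_less_one)
      show "bounded (S j)"
        by (rule bounded_subset[OF bounded_cbox]) (use cube_subset_cbox in \<open>auto simp: S_def\<close>)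
      show "1 - \<kappa> / 2 < 1" using \<kappa> by simp
      fix x e assume x: "x \<in> S j" and "(e::real) > 0"
      then have xQ: "x \<in> ?Q" by (auto simp: S_def)
      have "e / (2 * r * real ?n) > 0" using \<open>e > 0\<close> r by simp
      then obtain k where "(1/2) ^ k < e / (2 * r * real ?n)"
        using real_arch_pow_inv[of "e / (2 * r * real ?n)" "1/2"] by auto
      then have k: "2 * s k * real ?n < e"
        using r by (simp add: s_def field_simps)
      let ?d = "2 * s k * real ?n"
      let ?E = "{y \<in> ?Q. real j \<le> g y}"
      have E: "?E \<in> sets lebesgue"
        by measurable
      let ?U = "cball x ?d \<inter> ?E"
      have sub: "?U \<subseteq> (cball x ?d - R x k) \<union>
          {y \<in> R x k. norm (f y - cube_avg f (z x k) (s k)) \<ge> 2 * B}"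
      proof -
        have "2 * B \<le> norm (f y - cube_avg f (z x k) (s k))" if "real j \<le> g y" for y
        proof -
          have "2 \<le> \<bar>g y - a x k\<bar>" using x that by (auto simp: S_def dest: spec[of _ k])
          then have "B * 2 \<le> B * \<bar>g y - a x k\<bar>" using B by simp
          then show ?thesis using ga[of y x k] by simp
        qed
        then show ?thesis by auto
      qed
      have bad: "{y \<in> R x k. norm (f y - cube_avg f (z x k) (s k)) \<ge> 2 * B} \<in> lmeasurable"
        by (rule fmeasurableI2[OF Rl]) (use Rl in \<open>auto simp: fmeasurableD\<close>)
      have "measure lebesgue ?U \<le> measure lebesgue ((cball x ?d - R x k) \<union>
          {y \<in> R x k. norm (f y - cube_avg f (z x k) (s k)) \<ge> 2 * B})"
        using sub E bad Rl by (intro measure_mono_fmeasurable) (auto simp: fmeasurable.Un fmeasurable.Diff)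
      also have "\<dots> \<le> measure lebesgue (cball x ?d - R x k) +
          measure lebesgue {y \<in> R x k. norm (f y - cube_avg f (z x k) (s k)) \<ge> 2 * B}"
        using bad Rl by (intro measure_Un_le) (auto simp: fmeasurableD)
      also have "measure lebesgue (cball x ?d - R x k) = measure lebesgue (cball x ?d) - measure lebesgue (R x k)"
        using R(3)[OF xQ] Rl by (intro measurable_measure_Diff) (auto simp: fmeasurableD)
      also have "\<dots> + measure lebesgue {y \<in> R x k. norm (f y - cube_avg f (z x k) (s k)) \<ge> 2 * B} \<le>
          measure lebesgue (cball x ?d) - measure lebesgue (R x k) / 2"
        using half[OF xQ, of k] by simp
      also have "measure lebesgue (R x k) = \<kappa> * measure lebesgue (cball x ?d)"
        using s_pos[of k] order_less_imp_not_eq2[OF unit_ball_vol_pos[OF of_nat_0_le_iff]]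
        by (subst mR) (simp add: content_cball \<kappa>_def power_mult_distrib)
      finally have "measure lebesgue ?U \<le> (1 - \<kappa> / 2) * measure lebesgue (cball x ?d)"
        by (simp add: algebra_simps)
      moreover have "?U \<in> lmeasurable"
        using E by (intro fmeasurable_Int_fmeasurable) auto
      ultimately show "\<exists>d U. 0 < d \<and> d < e \<and> S j \<inter> cball x d \<subseteq> U \<and>
        U \<in> lmeasurable \<and> measure lebesgue U \<le> (1 - \<kappa> / 2) * measure lebesgue (cball x d)"
        using k s_pos[of k] by (intro exI[of _ ?d] exI[of _ ?U]) (auto simp: S_def)
    qed
  qed
  have step: "\<bar>a x (Suc k) - a x k\<bar> \<le> 2 ^ ?n" if "x \<in> ?Q" for x k
  proof -
    have 1: "cube (z x (Suc k)) (s (Suc k)) \<subseteq> cube (z x k) (s k)"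
    proof -
      have eq: "z x (Suc k) = x + (1/2) *\<^sub>R (z x k - x)" "s (Suc k) = (1/2) * s k"
        by (auto simp: z_def s_def)
      show ?thesis
        unfolding eq using R(1)[OF that, of k] by (intro homothetic_cube(2)) (auto simp: R_def)
    qed
    have "B * \<bar>a x (Suc k) - a x k\<bar> = \<bar>B * a x (Suc k) - B * a x k\<bar>"
      using B by (simp add: abs_mult flip: right_diff_distrib)
    also have "\<dots> \<le> norm ((cube_avg f (z x (Suc k)) (s (Suc k)) - cube_avg f c r) - (cube_avg f (z x k) (s k) - cube_avg f c r))"
      unfolding aB[symmetric] by (rule norm_triangle_ineq3)
    also have "\<dots> = norm (cube_avg f (z x (Suc k)) (s (Suc k)) - cube_avg f (z x k) (s k))" by simp
    also have "\<dots> \<le> (LINT y:R x k|lebesgue. norm (f y - cube_avg f (z x k) (s k))) / measure lebesgue (R x (Suc k))"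
      unfolding R_def by (rule norm_cube_avg_diff_le[OF f s_pos 1])
    also have "\<dots> \<le> (B * measure lebesgue (R x k)) / measure lebesgue (R x (Suc k))"
      using oscR[OF that] by (intro divide_right_mono) auto
    also have "\<dots> = B * 2 ^ ?n"
      using r unfolding mR by (simp add: s_def power_mult_distrib)
    finally show ?thesis using B by simp
  qed
  have a0: "a x 0 = 0" for x by (simp add: a_def z_def s_def)
  have main: "\<exists>z s. s > 0 \<and> x \<in> cube z s \<and> measure lebesgue (cube z s) / 2 \<le>
      measure lebesgue (cube z s \<inter> {y \<in> ?Q. \<bar>g y - real j\<bar> \<le> 4 + 2 ^ ?n})"
    if x: "x \<in> ?Q" "x \<notin> S j" "real j \<le> g x" for x j
  proof -
    define k where "k = (LEAST k. real j - 2 \<le> a x k)"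
    have "\<exists>k. real j - 2 \<le> a x k" using x unfolding S_def by (auto simp: not_less)
    then have k1: "real j - 2 \<le> a x k" unfolding k_def by (rule LeastI_ex)
    have k2: "\<bar>a x k - real j\<bar> \<le> 2 + 2 ^ ?n"
    proof (cases k)
      case 0
      then have "\<bar>a x k - real j\<bar> \<le> 2" using k1 a0[of x] by simp
      then show ?thesis by (rule order_trans) simp
    next
      case (Suc i)
      then have "\<not> real j - 2 \<le> a x i" unfolding k_def by (metis lessI not_less_Least)
      then show ?thesis using step[OF x(1), of i] k1 Suc by (simp add: abs_le_iff)
    qed
    let ?b = "{y \<in> R x k. norm (f y - cube_avg f (z x k) (s k)) \<ge> 2 * B}"
    let ?F = "{y \<in> ?Q. \<bar>g y - real j\<bar> \<le> 4 + 2 ^ ?n}"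
    have bad: "?b \<in> lmeasurable"
      by (rule fmeasurableI2[OF Rl]) (use Rl in \<open>auto simp: fmeasurableD\<close>)
    have "R x k - ?b \<subseteq> R x k \<inter> ?F"
    proof
      fix y assume y: "y \<in> R x k - ?b"
      then have "B * \<bar>g y - a x k\<bar> < B * 2" using ga[of y x k] by auto
      then have "\<bar>g y - a x k\<bar> < 2" using B by simp
      then have "\<bar>g y - real j\<bar> \<le> 4 + 2 ^ ?n" using k2 by linarith
      then show "y \<in> R x k \<inter> ?F" using y R(2)[OF x(1)] by auto
    qed
    then have "measure lebesgue (R x k - ?b) \<le> measure lebesgue (R x k \<inter> ?F)"
      using bad Rl by (intro measure_mono_fmeasurable fmeasurable_Int_fmeasurable) (auto simp: fmeasurableD)
    moreover have "measure lebesgue (R x k - ?b) = measure lebesgue (R x k) - measure lebesgue ?b"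
      using bad Rl by (intro measurable_measure_Diff) (auto simp: fmeasurableD)
    ultimately have "measure lebesgue (R x k) / 2 \<le> measure lebesgue (R x k \<inter> ?F)"
      using half[OF x(1), of k] by simp
    then show ?thesis
      using R(1)[OF x(1), of k] s_pos[of k] unfolding R_def by blast
  qed
  have "negligible (\<Union>j. S j)"
    using negl by (intro negligible_countable_Union) auto
  then have "AE x in lebesgue. x \<notin> (\<Union>j. S j)"
    using AE_not_in negligible_iff_null_sets by blast
  then show ?thesis
    by (rule AE_mp) (use main in auto)
qed

section \<open>The weight, the Campanato norm and the maximal function\<close>

text \<open>
  Comparability at distance at most \<open>r\<close> gives comparability at distance at most \<open>m * r\<close> by walking
  along the segment in \<open>m\<close> equal steps. It is needed for \<open>m = n\<close>, since the distance from the
  centre of a cube to its other points can exceed \<open>r\<close>.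
\<close>

lemma doubling_weight_chain:
  fixes \<phi> :: "real ^ 'n \<Rightarrow> real \<Rightarrow> real"
  assumes pos: "\<And>x r. r > 0 \<Longrightarrow> \<phi> x r > 0"
    and near: "\<And>x y r. r > 0 \<Longrightarrow> norm (x - y) \<le> r \<Longrightarrow> \<phi> x r \<le> C * \<phi> y r"
    and "C \<ge> 0" "r > 0" "norm (x - y) \<le> real m * r"
  shows "\<phi> x r \<le> C ^ m * \<phi> y r"
  using assms(5)
proof (induction m arbitrary: x)
  case (Suc m)
  define x' where "x' = x + (1 / real (Suc m)) *\<^sub>R (y - x)"
  have "norm (x - x') \<le> r"
  proof -
    have "x - x' = (1 / real (Suc m)) *\<^sub>R (x - y)" by (simp add: x'_def algebra_simps)
    then have "norm (x - x') = norm (x - y) / real (Suc m)" by simp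
    also have "\<dots> \<le> r" using Suc.prems by (simp add: field_simps)
    finally show ?thesis .
  qed
  moreover have "norm (x' - y) \<le> real m * r"
  proof -
    have "x' - y = (1 - 1 / real (Suc m)) *\<^sub>R (x - y)" by (simp add: x'_def algebra_simps)
    also have "1 - 1 / real (Suc m) = real m / real (Suc m)" by (simp add: field_simps)
    finally have "norm (x' - y) = real m * (norm (x - y) / real (Suc m))" by simp
    also have "\<dots> \<le> real m * r"
      using Suc.prems by (intro mult_left_mono) (auto simp: field_simps)
    finally show ?thesis .
  qed
  ultimately have "\<phi> x r \<le> C * \<phi> x' r" "\<phi> x' r \<le> C ^ m * \<phi> y r"
    using near \<open>r > 0\<close> Suc.IH by auto
  then show ?case
    using \<open>C \<ge> 0\<close> mult_left_mono[of "\<phi> x' r" "C ^ m * \<phi> y r" C] by (simp add: mult.assoc)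
qed simp

lemma campanato_term_eq:
  assumes "f \<in> L1_loc" "r > 0" "\<phi> x r \<ge> 0"
  shows "ennreal (\<phi> x r) * (1 / emeasure lebesgue (cube x r))
      * (\<integral>\<^sup>+y\<in>cube x r. ennreal (norm (f y - a)) \<partial>lebesgue)
    = ennreal (\<phi> x r * ((LINT y:cube x r|lebesgue. norm (f y - a)) / measure lebesgue (cube x r)))"
proof -
  have m: "measure lebesgue (cube x r) > 0" using assms by (intro measure_cube_pos)
  have p: "(LINT y:cube x r|lebesgue. norm (f y - a)) \<ge> 0"
    unfolding set_lebesgue_integral_def by (intro Bochner_Integration.integral_nonneg) auto
  have "1 / ennreal (measure lebesgue (cube x r)) = ennreal (1 / measure lebesgue (cube x r))"
    using divide_ennreal[of 1, OF _ m] by simp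
  then have "ennreal (\<phi> x r) * (1 / ennreal (measure lebesgue (cube x r))) *
      ennreal (LINT y:cube x r|lebesgue. norm (f y - a)) =
    ennreal (\<phi> x r * (1 / measure lebesgue (cube x r)) * (LINT y:cube x r|lebesgue. norm (f y - a)))"
    using assms(3) m p by (simp only: ennreal_mult mult_nonneg_nonneg divide_nonneg_pos zero_le_one)
  then show ?thesis
    unfolding nn_integral_cube_norm_diff[OF assms(1)] emeasure_cube
    by (simp only: mult.assoc times_divide_eq_left mult_1)
qed

lemma campanato_norm_osc:
  assumes "f \<in> L1_loc" "r > 0" "\<phi> x r \<ge> 0" "campanato_norm \<phi> f \<le> ennreal l" "l \<ge> 0"
  shows "\<phi> x r * ((LINT y:cube x r|lebesgue. norm (f y - cube_avg f x r)) / measure lebesgue (cube x r)) \<le> l"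
proof -
  have "ennreal (\<phi> x r) * (1 / emeasure lebesgue (cube x r))
      * (\<integral>\<^sup>+y\<in>cube x r. ennreal (norm (f y - cube_avg f x r)) \<partial>lebesgue) \<le> campanato_norm \<phi> f"
    unfolding campanato_norm_def using assms(2) by (intro SUP_upper2[of "(x, r)"]) auto
  also note assms(4)
  finally show ?thesis
    unfolding campanato_term_eq[of f r \<phi> x, OF assms(1-3)] using assms(5) by simp
qed

lemma HL_maximal_ge:
  assumes "r > 0" "x \<in> cube z r"
  shows "(\<integral>\<^sup>+y\<in>cube z r. ennreal (norm (f y)) \<partial>lebesgue) / emeasure lebesgue (cube z r) \<le> HL_maximal f x"
  unfolding HL_maximal_def using assms
  by (intro SUP_upper2[of "(z, r)"]) (auto simp: divide_ennreal_def mult.commute)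

lemma quasi_sBfsD:
  assumes "quasi_sBfs X N"
  shows "f \<in> X \<Longrightarrow> f \<in> L0"
    and "f \<in> X \<Longrightarrow> g \<in> L0 \<Longrightarrow> AE x in lebesgue. norm (g x) \<le> norm (f x) \<Longrightarrow> g \<in> X \<and> N g \<le> N f"
    and "r > 0 \<Longrightarrow> indicator (cube x r) \<in> X"
    and "f \<in> X \<Longrightarrow> (\<lambda>x. c * f x) \<in> X \<and> N (\<lambda>x. c * f x) = norm c * N f"
    and "f \<in> X \<Longrightarrow> N f \<ge> 0"
    and "f \<in> X \<Longrightarrow> N f = 0 \<longleftrightarrow> (AE x in lebesgue. f x = 0)"
proof -
  note conj = assms[unfolded quasi_sBfs_def quasi_Banach_in_L0_def]
  have sub: "X \<subseteq> L0"
    and lat: "\<forall>f\<in>X. \<forall>g\<in>L0. (AE x in lebesgue. norm (g x) \<le> norm (f x)) \<longrightarrow> g \<in> X \<and> N g \<le> N f"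
    and cub: "\<forall>x. \<forall>r>0. indicator (cube x r) \<in> X"
    and scX: "\<forall>c. \<forall>f\<in>X. (\<lambda>x. c * f x) \<in> X"
    and scN: "\<forall>c. \<forall>f\<in>X. N (\<lambda>x. c * f x) = norm c * N f"
    and pos: "\<forall>f\<in>X. 0 \<le> N f"
    and zer: "\<forall>f\<in>X. N f = 0 \<longleftrightarrow> (AE x in lebesgue. f x = 0)"
    using conj by - (elim conjE, assumption)+
  show "f \<in> X \<Longrightarrow> f \<in> L0" using sub by blast
  show "f \<in> X \<Longrightarrow> g \<in> L0 \<Longrightarrow> AE x in lebesgue. norm (g x) \<le> norm (f x) \<Longrightarrow> g \<in> X \<and> N g \<le> N f"
    using lat by simp
  show "r > 0 \<Longrightarrow> indicator (cube x r) \<in> X" using cub by simp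
  show "f \<in> X \<Longrightarrow> (\<lambda>x. c * f x) \<in> X \<and> N (\<lambda>x. c * f x) = norm c * N f" using scX scN by simp
  show "f \<in> X \<Longrightarrow> N f \<ge> 0" using pos by simp
  show "f \<in> X \<Longrightarrow> N f = 0 \<longleftrightarrow> (AE x in lebesgue. f x = 0)" using zer by simp
qed

lemma quasi_sBfs_cube_pos:
  assumes q: "quasi_sBfs X N" and r: "r > 0"
  shows "N (indicator (cube x r)) > 0"
proof -
  have X: "indicator (cube x r) \<in> X" using quasi_sBfsD(3)[OF q r] .
  have "N (indicator (cube x r)) \<noteq> 0"
  proof
    assume "N (indicator (cube x r)) = 0"
    then have "AE y in lebesgue. indicator (cube x r) y = (0::'b)"
      using quasi_sBfsD(6)[OF q X] by simp
    then have "AE y in lebesgue. y \<notin> cube x r" by (simp add: indicator_eq_0_iff)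
    then have "cube x r \<in> null_sets lebesgue" by (subst AE_iff_null_sets) auto
    then have "measure lebesgue (cube x r) = 0" by (rule measure_eq_0_null_sets)
    then show False using measure_cube_pos[OF r, of x] by linarith
  qed
  then show ?thesis using quasi_sBfsD(5)[OF q X] by linarith
qed

section \<open>The lower bound from the weak type estimate\<close>

text \<open>
  On \<open>Q\<close> the maximal function of \<open>g = (f - f\<^sub>Q) \<chi>\<^sub>Q\<close> is at least the mean oscillation \<open>A\<close> of \<open>f\<close> over
  \<open>Q\<close>. Hence for every \<open>l < A\<close> the superlevel set in the weak type inequality contains \<open>Q\<close>, and
  letting \<open>l\<close> tend to \<open>A\<close> gives \<open>A * N \<chi>\<^sub>Q \<le> C * N g\<close>. If \<open>g\<close> is not in \<open>X\<close>, the
  right-hand side is infinite.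
\<close>

lemma campanato_le_of_M_weakly_bounded:
  fixes X :: "(real ^ 'n \<Rightarrow> 'k::{real_normed_field, euclidean_space}) set"
  assumes q: "quasi_sBfs X N" and pos: "\<And>x r. r > 0 \<Longrightarrow> \<phi> x r > 0"
    and "C > 0"
    and weak: "\<And>l f. l > 0 \<Longrightarrow> f \<in> X \<Longrightarrow>
      ennreal l * ext_norm X N (indicator {x. HL_maximal f x > ennreal l}) \<le> ennreal C * ext_norm X N f"
    and f: "f \<in> L1_loc"
  shows "campanato_norm \<phi> f \<le> ennreal C * campanato_norm_X X N \<phi> f"
proof -
  have "ennreal (\<phi> x r) * (1 / emeasure lebesgue (cube x r))
      * (\<integral>\<^sup>+y\<in>cube x r. ennreal (norm (f y - cube_avg f x r)) \<partial>lebesgue)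
      \<le> ennreal C * campanato_norm_X X N \<phi> f" (is "?l \<le> _") if r: "r > 0" for x r
  proof -
    let ?Q = "cube x r"
    define g where "g y = (f y - cube_avg f x r) * indicator ?Q y" for y
    define A where "A = (LINT y:?Q|lebesgue. norm (f y - cube_avg f x r)) / measure lebesgue ?Q"
    let ?\<chi> = "indicator ?Q :: real ^ 'n \<Rightarrow> 'k"
    have \<chi>: "?\<chi> \<in> X" "N ?\<chi> > 0"
      using quasi_sBfsD(3)[OF q r] quasi_sBfs_cube_pos[OF q r] by auto
    have up: "ennreal (\<phi> x r) * (ext_norm X N g / ext_norm X N ?\<chi>) \<le> campanato_norm_X X N \<phi> f"
      unfolding campanato_norm_X_def g_def using r by (intro SUP_upper2[of "(x, r)"]) auto
    have l: "?l = ennreal (\<phi> x r * A)"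
      unfolding A_def using campanato_term_eq[of f r \<phi> x, OF f r] pos[OF r] by (simp add: less_imp_le)
    show ?thesis
    proof (cases "g \<in> X")
      case False
      then have "campanato_norm_X X N \<phi> f = top"
        using up \<chi> pos[OF r, of x]
        by (simp add: ext_norm_def ennreal_top_divide ennreal_mult_top top_unique split: if_splits)
      then show ?thesis using \<open>C > 0\<close> by (simp add: ennreal_mult_top)
    next
      case True
      have m: "measure lebesgue ?Q > 0" using r by (rule measure_cube_pos)
      have A: "ennreal A \<le> HL_maximal g y" if "y \<in> ?Q" for y
      proof -
        have "(\<integral>\<^sup>+y\<in>?Q. ennreal (norm (g y)) \<partial>lebesgue) =
            (\<integral>\<^sup>+y\<in>?Q. ennreal (norm (f y - cube_avg f x r)) \<partial>lebesgue)"
          by (intro nn_integral_cong) (auto simp: g_def indicator_def)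
        then have "(\<integral>\<^sup>+y\<in>?Q. ennreal (norm (g y)) \<partial>lebesgue) / emeasure lebesgue ?Q = ennreal A"
          using m unfolding nn_integral_cube_norm_diff[OF f] emeasure_cube A_def
          by (simp add: divide_ennreal set_lebesgue_integral_def Bochner_Integration.integral_nonneg)
        then show ?thesis using HL_maximal_ge[OF r that, of g] by simp
      qed
      have "A \<le> C * N g / N ?\<chi>"
      proof (cases "A > 0")
        case pA: True
        show ?thesis
        proof (rule dense_le_bounded[OF pA])
          fix l assume l: "0 < l" "l < A"
          let ?E = "{y. HL_maximal g y > ennreal l}"
          let ?e = "indicator ?E :: real ^ 'n \<Rightarrow> 'k"
          have w: "ennreal l * ext_norm X N ?e \<le> ennreal (C * N g)"
            using weak[OF l(1) True] True \<open>C > 0\<close> by (simp add: ext_norm_def ennreal_mult')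
          then have eX: "?e \<in> X"
            using l by (auto simp: ext_norm_def ennreal_mult_top top_unique split: if_splits)
          have "ennreal (l * N ?e) \<le> ennreal (C * N g)"
            using w eX l ennreal_mult'[of l "N ?e"] by (simp add: ext_norm_def)
          moreover have "0 \<le> C * N g"
            using \<open>C > 0\<close> quasi_sBfsD(5)[OF q True] by simp
          ultimately have le: "l * N ?e \<le> C * N g"
            using ennreal_le_iff by blast
          have sub: "?Q \<subseteq> ?E"
          proof
            fix y assume "y \<in> ?Q"
            then have "ennreal A \<le> HL_maximal g y" by (rule A)
            moreover have "ennreal l < ennreal A" using l by (simp add: ennreal_lessI)
            ultimately have "ennreal l < HL_maximal g y" by (rule less_le_trans[rotated])
            then show "y \<in> ?E" by simp
          qed
          have "norm (?\<chi> y) \<le> norm (?e y)" for y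
            using sub by (auto simp: indicator_def)
          then have "N ?\<chi> \<le> N ?e"
            using quasi_sBfsD(2)[OF q eX quasi_sBfsD(1)[OF q \<chi>(1)]] by simp
          then have "l * N ?\<chi> \<le> C * N g"
            using le l mult_left_mono[of "N ?\<chi>" "N ?e" l] by linarith
          then show "l \<le> C * N g / N ?\<chi>" using \<chi> by (simp add: field_simps)
        qed
      next
        case False
        moreover have "0 \<le> C * N g / N ?\<chi>"
          using \<chi>(2) \<open>C > 0\<close> quasi_sBfsD(5)[OF q True] by simp
        ultimately show ?thesis by linarith
      qed
      then have "\<phi> x r * A \<le> C * (\<phi> x r * (N g / N ?\<chi>))"
        using mult_left_mono[of A "C * N g / N ?\<chi>" "\<phi> x r"] less_imp_le[OF pos[OF r, of x]]
        by (simp add: mult_ac)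
      then have "?l \<le> ennreal C * ennreal (\<phi> x r * (N g / N ?\<chi>))"
        unfolding l ennreal_mult'[OF less_imp_le[OF \<open>C > 0\<close>], symmetric] by (rule ennreal_leI)
      also have "ennreal (\<phi> x r * (N g / N ?\<chi>)) = ennreal (\<phi> x r) * (ext_norm X N g / ext_norm X N ?\<chi>)"
        using True \<chi> divide_ennreal[OF quasi_sBfsD(5)[OF q True] \<chi>(2)]
        by (simp only: ext_norm_def if_True ennreal_mult'[OF less_imp_le[OF pos[OF r]]])
      also have "ennreal C * \<dots> \<le> ennreal C * campanato_norm_X X N \<phi> f"
        by (intro mult_left_mono up) auto
      finally show ?thesis .
    qed
  qed
  then show ?thesis
    unfolding campanato_norm_def by (intro SUP_least) auto
qed

section \<open>The upper bound from the vector-valued inequality\<close>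

lemma infsum_ennreal_eq_SUP:
  fixes f :: "'a \<Rightarrow> ennreal"
  shows "infsum f UNIV = (SUP F\<in>{F. finite F}. sum f F)"
  using nonneg_infsum_complete[of UNIV f] by simp

text \<open>There are only countably many finite index sets, so the supremum of the partial sums is measurable.\<close>

lemma borel_measurable_infsum_ennreal:
  fixes f :: "'a::countable \<Rightarrow> 'b \<Rightarrow> ennreal"
  assumes "\<And>i. f i \<in> borel_measurable M"
  shows "(\<lambda>x. infsum (\<lambda>i. f i x) UNIV) \<in> borel_measurable M"
  unfolding infsum_ennreal_eq_SUP using assms
  by (intro borel_measurable_SUP borel_measurable_sum) (auto intro: countable_Collect_finite)

lemma enn_powr_ge:
  assumes "ennreal a \<le> b" "a \<ge> 0" "p > 0"
  shows "ennreal (a powr p) \<le> enn_powr b p"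
proof (cases "b = top")
  case False
  then have "a \<le> enn2real b"
    using enn2real_mono[OF assms(1)] assms(2) by (simp add: less_top)
  then show ?thesis using False assms by (simp add: enn_powr_def powr_mono2 ennreal_leI)
qed (simp add: enn_powr_def)

lemma card_ints_near:
  fixes u K :: real
  assumes "finite G" "\<And>j::int. j \<in> G \<Longrightarrow> \<bar>u - real_of_int j\<bar> \<le> K" "K \<ge> 0"
  shows "real (card G) \<le> 2 * K + 1"
proof -
  have "G \<subseteq> {\<lceil>u - K\<rceil>..\<lfloor>u + K\<rfloor>}"
    using assms(2) by (force simp: ceiling_le_iff le_floor_iff abs_le_iff)
  then have "card G \<le> card {\<lceil>u - K\<rceil>..\<lfloor>u + K\<rfloor>}" by (intro card_mono) auto
  also have "\<dots> = nat (\<lfloor>u + K\<rfloor> - \<lceil>u - K\<rceil> + 1)" by simp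
  finally have "real (card G) \<le> real (nat (\<lfloor>u + K\<rfloor> - \<lceil>u - K\<rceil> + 1))" by linarith
  also have "\<dots> \<le> 2 * K + 1"
    using assms(3) floor_correct[of "u + K"] ceiling_correct[of "u - K"] by (simp add: nat_eq_iff) linarith
  finally show ?thesis .
qed

lemma HL_maximal_indicator_ge:
  fixes F :: "(real ^ 'n) set"
  assumes "s > 0" "x \<in> cube z s" "F \<in> sets lebesgue"
    and "measure lebesgue (cube z s) / 2 \<le> measure lebesgue (cube z s \<inter> F)"
  shows "ennreal (1/2) \<le> HL_maximal (indicator F :: _ \<Rightarrow> 'k::{real_normed_field, euclidean_space}) x"
proof -
  have m: "measure lebesgue (cube z s) > 0" using assms(1) by (rule measure_cube_pos)
  have "cube z s \<inter> F \<in> lmeasurable"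
    using assms(3) by (intro fmeasurable_Int_fmeasurable) auto
  then have e: "emeasure lebesgue (cube z s \<inter> F) = ennreal (measure lebesgue (cube z s \<inter> F))"
    by (rule emeasure_eq_measure2)
  have "(\<integral>\<^sup>+y\<in>cube z s. ennreal (norm (indicator F y :: 'k)) \<partial>lebesgue) =
      (\<integral>\<^sup>+y. indicator (cube z s \<inter> F) y \<partial>lebesgue)"
    by (intro nn_integral_cong) (auto simp: indicator_def)
  also have "\<dots> = ennreal (measure lebesgue (cube z s \<inter> F))"
    unfolding e[symmetric] using assms(3) by (intro nn_integral_indicator) auto
  finally have "(\<integral>\<^sup>+y\<in>cube z s. ennreal (norm (indicator F y :: 'k)) \<partial>lebesgue) / emeasure lebesgue (cube z s) =
      ennreal (measure lebesgue (cube z s \<inter> F) / measure lebesgue (cube z s))"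
    unfolding emeasure_cube using divide_ennreal[OF measure_nonneg m] by simp
  moreover have "1/2 \<le> measure lebesgue (cube z s \<inter> F) / measure lebesgue (cube z s)"
    using assms(4) m by (simp only: le_divide_eq) simp
  ultimately show ?thesis
    using HL_maximal_ge[OF assms(1,2), of "indicator F :: _ \<Rightarrow> 'k"] ennreal_leI by (metis order_trans)
qed

text \<open>
  The vector-valued inequality is applied to the characteristic functions of the level sets
  \<open>F j = {y \<in> Q. \<bar>g y - j\<bar> \<le> K}\<close>, \<open>j \<ge> 0\<close>. Every point lies in at most \<open>2 * K + 1\<close> of them, so the
  right-hand side is at most a multiple of the norm of \<open>\<chi>\<^sub>Q\<close>. By \<open>AE_level_set_dense_on_cube\<close>,
  at almost every \<open>x \<in> Q\<close> those of \<open>F 0, \<dots>, F \<lfloor>g x\<rfloor>\<close> have maximal functions at least \<open>1/2\<close>, so the sum on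
  the left-hand side is at least a multiple of \<open>g x\<close>: there are as many level sets as \<open>g x\<close> is large.
\<close>

lemma norm_oscillation_le_of_M_vector_bounded:
  fixes X :: "(real ^ 'n \<Rightarrow> 'k::{real_normed_field, euclidean_space}) set"
    and f :: "real ^ 'n \<Rightarrow> 'k"
  assumes q: "quasi_sBfs X N" and M: "M_vector_bounded X N \<eta> C" and "\<eta> > 0" "C > 0"
    and f: "f \<in> L1_loc" and r: "r > 0" and B: "B > 0"
    and osc: "\<And>z s. 0 < s \<Longrightarrow> s \<le> r \<Longrightarrow> norm (z - c) \<le> real CARD('n) * r \<Longrightarrow>
      (LINT y:cube z s|lebesgue. norm (f y - cube_avg f z s)) \<le> B * measure lebesgue (cube z s)"
  defines "u \<equiv> (\<lambda>y. (f y - cube_avg f c r) * indicator (cube c r) y)"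
  shows "u \<in> X"
    and "N u \<le> B * (2 powr \<eta> * (C * (9 + 2 * 2 ^ CARD('n)))) * N (indicator (cube c r))"
proof -
  let ?Q = "cube c r"
  define K :: real where "K = 4 + 2 ^ CARD('n)"
  have K: "K \<ge> 0" by (simp add: K_def)
  define P where "P = 2 * K + 1"
  have P: "P > 0" using K unfolding P_def by linarith
  define g where "g y = norm (f y - cube_avg f c r) / B" for y
  have g0: "g y \<ge> 0" for y using B by (simp add: g_def)
  have fm [measurable]: "f \<in> borel_measurable lebesgue"
    using f by (simp add: L1_loc_def L0_def)
  have gm [measurable]: "g \<in> borel_measurable lebesgue"
    unfolding g_def by measurable
  \<comment> \<open>the inequality is indexed by the integers; only the levels \<open>j \<ge> 0\<close> matter, as \<open>g \<ge> 0\<close>\<close>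
  define F where "F j = (if j \<ge> 0 then {y \<in> ?Q. \<bar>g y - real_of_int j\<bar> \<le> K} else {})" for j :: int
  have Fm [measurable]: "F j \<in> sets lebesgue" for j
    unfolding F_def by (cases "j \<ge> 0") (simp_all, measurable)
  define h where "h j = (indicator (F j) :: real ^ 'n \<Rightarrow> 'k)" for j
  have hL: "h j \<in> L0" for j
    unfolding h_def L0_def by (intro borel_measurable_indicator Fm)
  let ?\<chi> = "indicator ?Q :: real ^ 'n \<Rightarrow> 'k"
  have \<chi>: "?\<chi> \<in> X" "N ?\<chi> > 0"
    using quasi_sBfsD(3)[OF q r] quasi_sBfs_cube_pos[OF q r] by auto
  define h1 where "h1 x = (\<Sum>\<^sub>\<infinity>j\<in>UNIV. enn_powr (HL_maximal (h j) x) \<eta>)" for x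
  define h2 where "h2 x = (\<Sum>\<^sub>\<infinity>j\<in>UNIV. enn_powr (ennreal (norm (h j x))) \<eta>)" for x
  have vec: "ext_norm_nn X N h1 \<le> ennreal C * ext_norm_nn X N h2"
    using M hL unfolding M_vector_bounded_def h1_def h2_def by blast
  have h2_eq: "h2 x = (\<Sum>\<^sub>\<infinity>j\<in>UNIV. indicator (F j) x)" for x
    unfolding h2_def h_def using \<open>\<eta> > 0\<close>
    by (intro infsum_cong) (auto simp: enn_powr_def indicator_def)
  have h2_le: "h2 x \<le> ennreal P * indicator ?Q x" for x
    unfolding h2_eq infsum_ennreal_eq_SUP
  proof (rule SUP_least)
    fix G :: "int set" assume "G \<in> {F. finite F}"
    then have G: "finite G" by simp
    have "(\<Sum>j\<in>G. indicator (F j) x) = (\<Sum>j\<in>{j\<in>G. x \<in> F j}. 1::ennreal)"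
      using G by (intro sum.mono_neutral_cong_right) (auto simp: indicator_def)
    also have "\<dots> = of_nat (card {j\<in>G. x \<in> F j})" by simp
    also have "\<dots> = ennreal (real (card {j\<in>G. x \<in> F j}))" by (rule ennreal_of_nat_eq_real_of_nat)
    also have "\<dots> \<le> ennreal P * indicator ?Q x"
    proof (cases "x \<in> ?Q")
      case True
      have "real (card {j\<in>G. x \<in> F j}) \<le> P"
        unfolding P_def using G K by (intro card_ints_near[of _ "g x"]) (auto simp: F_def split: if_splits)
      then show ?thesis using True by (simp add: ennreal_leI)
    next
      case False
      then have "{j\<in>G. x \<in> F j} = {}" by (auto simp: F_def split: if_splits)
      then show ?thesis by (simp only: card.empty) simp
    qed
    finally show "(\<Sum>j\<in>G. indicator (F j) x) \<le> ennreal P * indicator ?Q x" .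
  qed
  have h2m [measurable]: "h2 \<in> borel_measurable lebesgue"
    unfolding h2_eq[abs_def] by (intro borel_measurable_infsum_ennreal) measurable
  define H2 where "H2 x = (of_real (enn2real (h2 x)) :: 'k)" for x
  have H2L: "H2 \<in> L0"
    unfolding H2_def[abs_def] L0_def of_real_def by measurable
  have H2le: "norm (H2 x) \<le> norm (of_real P * ?\<chi> x)" for x
  proof -
    have "enn2real (h2 x) \<le> P * indicator ?Q x"
      using h2_le[of x] P by (intro enn2real_leI) (auto simp: indicator_def split: if_splits)
    then show ?thesis using P by (cases "x \<in> ?Q") (simp_all add: H2_def norm_mult)
  qed
  have PX: "(\<lambda>x. of_real P * ?\<chi> x) \<in> X" "N (\<lambda>x. of_real P * ?\<chi> x) = P * N ?\<chi>"
    using quasi_sBfsD(4)[OF q \<chi>(1), of "of_real P"] P by simp_all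
  have H2: "H2 \<in> X" "N H2 \<le> P * N ?\<chi>"
    using quasi_sBfsD(2)[OF q PX(1) H2L] H2le PX(2) by auto
  have h2fin: "h2 x \<noteq> top" for x
    using h2_le[of x] by (cases "x \<in> ?Q") (auto simp: top_unique)
  have "ext_norm_nn X N h2 = ennreal (N H2)"
    using h2fin H2(1) by (simp add: ext_norm_nn_def ext_norm_def H2_def[abs_def])
  then have vec2: "ext_norm_nn X N h1 \<le> ennreal (C * N H2)"
    using vec \<open>C > 0\<close> by (simp add: ennreal_mult')
  define H1 where "H1 x = (of_real (enn2real (h1 x)) :: 'k)" for x
  have h1fin: "AE x in lebesgue. h1 x \<noteq> top"
    using vec2 by (auto simp: ext_norm_nn_def top_unique split: if_splits)
  then have e1: "ext_norm_nn X N h1 = ext_norm X N H1"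
    by (simp add: ext_norm_nn_def H1_def[abs_def])
  then have H1: "H1 \<in> X"
    using vec2 by (auto simp: ext_norm_def top_unique split: if_splits)
  then have "N H1 \<le> C * N H2"
    using vec2 e1 \<open>C > 0\<close> quasi_sBfsD(5)[OF q H2(1)] by (simp add: ext_norm_def)
  also have "\<dots> \<le> C * (P * N ?\<chi>)"
    using H2(2) \<open>C > 0\<close> by (intro mult_left_mono) auto
  finally have NH1: "N H1 \<le> C * (P * N ?\<chi>)" .
  have dense: "AE x in lebesgue. x \<in> ?Q \<longrightarrow> (\<forall>j::nat. real j \<le> g x \<longrightarrow>
    (\<exists>z s. s > 0 \<and> x \<in> cube z s \<and> measure lebesgue (cube z s) / 2 \<le>
      measure lebesgue (cube z s \<inter> {y \<in> ?Q. \<bar>g y - real j\<bar> \<le> K})))"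
    unfolding g_def K_def by (rule AE_level_set_dense_on_cube[OF f r B osc])
  have low: "ennreal (g x * (1/2) powr \<eta>) \<le> h1 x"
    if x: "x \<in> ?Q" and *: "\<forall>j::nat. real j \<le> g x \<longrightarrow>
    (\<exists>z s. s > 0 \<and> x \<in> cube z s \<and> measure lebesgue (cube z s) / 2 \<le>
      measure lebesgue (cube z s \<inter> {y \<in> ?Q. \<bar>g y - real j\<bar> \<le> K}))" for x
  proof -
    have each: "ennreal ((1/2) powr \<eta>) \<le> enn_powr (HL_maximal (h j) x) \<eta>" if j: "j \<in> {0..\<lfloor>g x\<rfloor>}" for j
    proof -
      have jn: "real (nat j) = real_of_int j" using j by simp
      have "real (nat j) \<le> g x" unfolding jn using j by (simp add: le_floor_iff)
      then obtain z s where s: "s > 0" "x \<in> cube z s"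
        "measure lebesgue (cube z s) / 2 \<le> measure lebesgue (cube z s \<inter> {y \<in> ?Q. \<bar>g y - real (nat j)\<bar> \<le> K})"
        using * by blast
      have "F j = {y \<in> ?Q. \<bar>g y - real (nat j)\<bar> \<le> K}" unfolding jn using j by (simp add: F_def)
      then have "ennreal (1/2) \<le> HL_maximal (h j) x"
        unfolding h_def using s by (intro HL_maximal_indicator_ge[OF s(1,2) Fm]) simp
      then show ?thesis using \<open>\<eta> > 0\<close> by (intro enn_powr_ge) auto
    qed
    have "g x * (1/2) powr \<eta> \<le> real (card {0..\<lfloor>g x\<rfloor>}) * (1/2) powr \<eta>"
    proof (rule mult_right_mono)
      have "real (card {0..\<lfloor>g x\<rfloor>}) = real_of_int \<lfloor>g x\<rfloor> + 1" using g0[of x] by simp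
      then show "g x \<le> real (card {0..\<lfloor>g x\<rfloor>})" by linarith
    qed simp
    then have "ennreal (g x * (1/2) powr \<eta>) \<le> ennreal (real (card {0..\<lfloor>g x\<rfloor>}) * (1/2) powr \<eta>)"
      by (rule ennreal_leI)
    also have "\<dots> = (\<Sum>j\<in>{0..\<lfloor>g x\<rfloor>}. ennreal ((1/2) powr \<eta>))"
      by (simp add: ennreal_mult ennreal_of_nat_eq_real_of_nat)
    also have "\<dots> \<le> (\<Sum>j\<in>{0..\<lfloor>g x\<rfloor>}. enn_powr (HL_maximal (h j) x) \<eta>)"
      using each by (rule sum_mono)
    also have "\<dots> \<le> h1 x"
      unfolding h1_def infsum_ennreal_eq_SUP by (intro SUP_upper) auto
    finally show ?thesis .
  qed
  let ?D = "B * 2 powr \<eta>"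
  have D: "?D > 0" using B by simp
  have ule: "AE x in lebesgue. norm (u x) \<le> norm (of_real ?D * H1 x)"
    using h1fin dense
  proof eventually_elim
    case (elim x)
    show ?case
    proof (cases "x \<in> ?Q")
      case True
      then have "ennreal (g x * (1/2) powr \<eta>) \<le> h1 x" using low elim by blast
      then have "g x * (1/2) powr \<eta> \<le> enn2real (h1 x)"
        using elim(1) g0[of x] enn2real_mono[of "ennreal (g x * (1/2) powr \<eta>)" "h1 x"]
        by (simp add: less_top)
      then have "?D * (g x * (1/2) powr \<eta>) \<le> ?D * enn2real (h1 x)"
        using D by (intro mult_left_mono) auto
      moreover have "?D * (g x * (1/2) powr \<eta>) = norm (u x)"
      proof -
        have "2 powr \<eta> * (1/2) powr \<eta> = (1::real)" by (simp flip: powr_mult)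
        then have "?D * (g x * (1/2) powr \<eta>) = B * g x" by (simp add: mult_ac)
        also have "\<dots> = norm (u x)" using True B by (simp add: g_def u_def)
        finally show ?thesis .
      qed
      moreover have "norm (of_real ?D * H1 x) = ?D * enn2real (h1 x)"
        using B by (simp add: H1_def norm_mult)
      ultimately show ?thesis by linarith
    qed (simp add: u_def)
  qed
  have uL: "u \<in> L0"
    unfolding u_def L0_def
    by (intro borel_measurable_times borel_measurable_diff fm borel_measurable_const borel_measurable_indicator) auto
  have DX: "(\<lambda>x. of_real ?D * H1 x) \<in> X" "N (\<lambda>x. of_real ?D * H1 x) = ?D * N H1"
    using quasi_sBfsD(4)[OF q H1, of "of_real ?D"] B by (simp_all add: norm_mult)
  have uX: "u \<in> X \<and> N u \<le> ?D * N H1"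
    using quasi_sBfsD(2)[OF q DX(1) uL ule] DX(2) by simp
  then show "u \<in> X" by simp
  have "N u \<le> ?D * N H1" using uX by simp
  also have "\<dots> \<le> ?D * (C * (P * N ?\<chi>))"
    using NH1 D by (intro mult_left_mono) auto
  finally show "N u \<le> B * (2 powr \<eta> * (C * (9 + 2 * 2 ^ CARD('n)))) * N ?\<chi>"
    by (simp add: P_def K_def algebra_simps)
qed

text \<open>
  The hypothesis \<open>smaller\<close> turns the Campanato norm, which bounds \<open>\<phi> z s\<close> times the oscillation over
  each small cube, into a bound for all those oscillations in terms of \<open>\<phi>\<close> at the large cube.
\<close>

lemma campanato_X_le_of_M_vector_bounded:
  fixes X :: "(real ^ 'n \<Rightarrow> 'k::{real_normed_field, euclidean_space}) set"
    and f :: "real ^ 'n \<Rightarrow> 'k"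
  assumes q: "quasi_sBfs X N" and M: "M_vector_bounded X N \<eta> C" and "\<eta> > 0" "C > 0"
    and pos: "\<And>x r. r > 0 \<Longrightarrow> \<phi> x r > 0"
    and smaller: "\<And>x z r s. 0 < s \<Longrightarrow> s \<le> r \<Longrightarrow> norm (z - x) \<le> real CARD('n) * r \<Longrightarrow>
      \<phi> x r \<le> D * \<phi> z s" and "D > 0"
    and f: "f \<in> L1_loc"
  shows "campanato_norm_X X N \<phi> f \<le>
    ennreal (D * (2 powr \<eta> * (C * (9 + 2 * 2 ^ CARD('n))))) * campanato_norm \<phi> f"
proof -
  define E where "E = 2 powr \<eta> * (C * (9 + 2 * 2 ^ CARD('n)))"
  have E: "E > 0"
    unfolding E_def using \<open>C > 0\<close> by (intro mult_pos_pos add_pos_pos) auto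
  have "campanato_norm_X X N \<phi> f \<le> ennreal (D * E) * campanato_norm \<phi> f"
  proof (cases "campanato_norm \<phi> f")
    case top
    have "ennreal (D * E) * campanato_norm \<phi> f = top"
      unfolding top using E \<open>D > 0\<close> by (simp add: ennreal_mult_top)
    then show ?thesis by simp
  next
    case (real l)
    have "ennreal (\<phi> c r) * (ext_norm X N (\<lambda>y. (f y - cube_avg f c r) * indicator (cube c r) y)
        / ext_norm X N (indicator (cube c r))) \<le> ennreal (D * E * l)" if r: "r > 0" for c r
    proof -
      define u where "u = (\<lambda>y. (f y - cube_avg f c r) * indicator (cube c r) y)"
      let ?\<chi> = "indicator (cube c r) :: real ^ 'n \<Rightarrow> 'k"
      have \<chi>: "?\<chi> \<in> X" "N ?\<chi> > 0"
        using quasi_sBfsD(3)[OF q r] quasi_sBfs_cube_pos[OF q r] by auto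
      have \<phi>: "\<phi> c r > 0" using pos r by blast
      have key: "u \<in> X \<and> \<phi> c r * (N u / N ?\<chi>) \<le> D * E * l + e" if "e > 0" for e
      proof -
        \<comment> \<open>the summand with \<open>e\<close> keeps \<open>B\<close> positive when the Campanato norm vanishes\<close>
        define B where "B = (l + e / (D * E)) * D / \<phi> c r"
        have l: "l + e / (D * E) > l" using \<open>e > 0\<close> \<open>D > 0\<close> E by simp
        have B: "B > 0"
          unfolding B_def using l real \<open>D > 0\<close> \<phi> by (intro divide_pos_pos mult_pos_pos) auto
        have osc: "(LINT y:cube z s|lebesgue. norm (f y - cube_avg f z s)) \<le> B * measure lebesgue (cube z s)"
          if s: "0 < s" "s \<le> r" "norm (z - c) \<le> real CARD('n) * r" for z s
        proof -
          let ?A = "(LINT y:cube z s|lebesgue. norm (f y - cube_avg f z s)) / measure lebesgue (cube z s)"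
          have m: "measure lebesgue (cube z s) > 0" using s(1) by (rule measure_cube_pos)
          have A: "?A \<ge> 0"
            unfolding set_lebesgue_integral_def
            by (intro divide_nonneg_nonneg Bochner_Integration.integral_nonneg) auto
          have "\<phi> z s * ?A \<le> l"
            using campanato_norm_osc[OF f s(1), of \<phi> z l] pos[OF s(1), of z] real by simp
          then have "D * (\<phi> z s * ?A) \<le> D * l"
            using \<open>D > 0\<close> by (intro mult_left_mono) auto
          moreover have "\<phi> c r * ?A \<le> (D * \<phi> z s) * ?A"
            using smaller[OF s] A by (rule mult_right_mono)
          moreover have "D * l \<le> (l + e / (D * E)) * D"
            using l \<open>D > 0\<close> by (simp add: mult.commute)
          ultimately have "\<phi> c r * ?A \<le> (l + e / (D * E)) * D"
            unfolding mult.assoc[of D "\<phi> z s" ?A] by linarith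
          then have "?A * \<phi> c r \<le> (l + e / (D * E)) * D" by (subst mult.commute)
          then have "?A \<le> B" unfolding B_def by (rule iffD2[OF pos_le_divide_eq[OF \<phi>]])
          then show ?thesis by (rule iffD1[OF pos_divide_le_eq[OF m]])
        qed
        have "u \<in> X" and "N u \<le> B * E * N ?\<chi>"
          unfolding u_def E_def
          by (rule norm_oscillation_le_of_M_vector_bounded[OF q M \<open>\<eta> > 0\<close> \<open>C > 0\<close> f r B osc]; assumption)+
        then have "N u / N ?\<chi> \<le> B * E" by (intro iffD2[OF pos_divide_le_eq[OF \<chi>(2)]])
        then have "\<phi> c r * (N u / N ?\<chi>) \<le> \<phi> c r * (B * E)"
          using \<phi> by (intro mult_left_mono) auto
        also have "\<dots> = D * E * l + e"
        proof -
          have "\<phi> c r * (B * E) = (l + e / (D * E)) * (D * E)" unfolding B_def using \<phi> by simp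
          also have "\<dots> = l * (D * E) + e / (D * E) * (D * E)" by (rule distrib_right)
          also have "\<dots> = D * E * l + e" using \<open>D > 0\<close> E by simp
          finally show ?thesis .
        qed
        finally show ?thesis using \<open>u \<in> X\<close> by blast
      qed
      have "u \<in> X" using key[of 1] by simp
      have "\<phi> c r * (N u / N ?\<chi>) \<le> D * E * l"
        by (rule field_le_epsilon) (use key in blast)
      moreover have "ennreal (\<phi> c r) * (ext_norm X N u / ext_norm X N ?\<chi>) = ennreal (\<phi> c r * (N u / N ?\<chi>))"
        using \<open>u \<in> X\<close> \<chi>(1) divide_ennreal[OF quasi_sBfsD(5)[OF q \<open>u \<in> X\<close>] \<chi>(2)]
        by (simp only: ext_norm_def if_True ennreal_mult'[OF less_imp_le[OF \<phi>]])
      ultimately have "ennreal (\<phi> c r) * (ext_norm X N u / ext_norm X N ?\<chi>) \<le> ennreal (D * E * l)"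
        by (simp only: ennreal_leI)
      then show ?thesis unfolding u_def .
    qed
    then have "campanato_norm_X X N \<phi> f \<le> ennreal (D * E * l)"
      unfolding campanato_norm_X_def by (intro SUP_least) auto
    also have "\<dots> = ennreal (D * E) * ennreal l"
      using real \<open>D > 0\<close> E by (intro ennreal_mult) auto
    finally show ?thesis unfolding real .
  qed
  then show ?thesis unfolding E_def .
qed

section \<open>Equivalence of the norms\<close>

theorem theorem1p7:
  fixes X :: "(real ^ 'n \<Rightarrow> 'k::{real_normed_field, euclidean_space}) set"
    and N :: "(real ^ 'n \<Rightarrow> 'k) \<Rightarrow> real"
    and \<phi> :: "real ^ 'n \<Rightarrow> real \<Rightarrow> real"
  assumes "quasi_sBfs X N"
    and "\<And>x r. r > 0 \<Longrightarrow> \<phi> x r > 0"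
    and "\<exists>C>0. \<forall>x r s. r \<ge> s \<and> s > 0 \<longrightarrow> \<phi> x r \<le> C * \<phi> x s"
    and "\<exists>C\<ge>1. \<forall>x y r. r > 0 \<and> norm (x - y) \<le> r \<longrightarrow>
           1 / C \<le> \<phi> x r / \<phi> y r \<and> \<phi> x r / \<phi> y r \<le> C"
  shows
    "(M_weakly_bounded X N \<longrightarrow>
       (\<exists>C>0. \<forall>f\<in>L1_loc. campanato_norm \<phi> f \<le> ennreal C * campanato_norm_X X N \<phi> f)) \<and>
     ((\<exists>\<eta>>1. \<exists>C>0. M_vector_bounded X N \<eta> C) \<longrightarrow>
       (\<exists>C>0. \<forall>f\<in>L1_loc. campanato_norm_X X N \<phi> f \<le> ennreal C * campanato_norm \<phi> f))"
proof (intro conjI impI)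
  assume "M_weakly_bounded X N"
  then obtain C where C: "C > 0" and weak: "\<forall>l>0. \<forall>f\<in>X.
      ennreal l * ext_norm X N (indicator {x. HL_maximal f x > ennreal l}) \<le> ennreal C * ext_norm X N f"
    unfolding M_weakly_bounded_def by blast
  have "campanato_norm \<phi> f \<le> ennreal C * campanato_norm_X X N \<phi> f" if "f \<in> L1_loc" for f
    by (rule campanato_le_of_M_weakly_bounded[OF assms(1,2) C weak[rule_format] that])
  then show "\<exists>C>0. \<forall>f\<in>L1_loc. campanato_norm \<phi> f \<le> ennreal C * campanato_norm_X X N \<phi> f"
    using C by blast
next
  assume "\<exists>\<eta>>1. \<exists>C>0. M_vector_bounded X N \<eta> C"
  then obtain \<eta> C where \<eta>: "\<eta> > 1" "C > 0" "M_vector_bounded X N \<eta> C" by blast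
  obtain C1 where C1: "C1 > 0" "\<And>x r s. r \<ge> s \<Longrightarrow> s > 0 \<Longrightarrow> \<phi> x r \<le> C1 * \<phi> x s"
    using assms(3) by blast
  obtain C2 where C2: "C2 \<ge> 1" "\<And>x y r. r > 0 \<Longrightarrow> norm (x - y) \<le> r \<Longrightarrow> \<phi> x r / \<phi> y r \<le> C2"
    using assms(4) by blast
  have near: "\<phi> x r \<le> C2 * \<phi> y r" if "r > 0" "norm (x - y) \<le> r" for x y r
    by (rule iffD1[OF pos_divide_le_eq[OF assms(2)[OF that(1)]] C2(2)[OF that]])
  define D where "D = C2 ^ CARD('n) * C1"
  have D: "D > 0" unfolding D_def using C1 C2 by (intro mult_pos_pos zero_less_power) auto
  have smaller: "\<phi> x r \<le> D * \<phi> z s"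
    if s: "0 < s" "s \<le> r" "norm (z - x) \<le> real CARD('n) * r" for x z r s
  proof -
    have "\<phi> x r \<le> C2 ^ CARD('n) * \<phi> z r"
    proof (rule doubling_weight_chain[of \<phi> C2, OF assms(2) near])
      show "0 \<le> C2" "0 < r" using s C2(1) by simp_all
      show "norm (x - z) \<le> real CARD('n) * r" using s(3) by (simp only: norm_minus_commute)
    qed
    also have "\<dots> \<le> C2 ^ CARD('n) * (C1 * \<phi> z s)"
      using C1(2)[OF s(2,1)] C2(1) by (intro mult_left_mono) auto
    finally show ?thesis by (simp only: D_def mult.assoc)
  qed
  define E where "E = D * (2 powr \<eta> * (C * (9 + 2 * 2 ^ CARD('n))))"
  have "E > 0"
    unfolding E_def using \<eta> D by (intro mult_pos_pos add_pos_pos) auto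
  moreover have "campanato_norm_X X N \<phi> f \<le> ennreal E * campanato_norm \<phi> f" if "f \<in> L1_loc" for f
    unfolding E_def using \<eta>(1)
    by (intro campanato_X_le_of_M_vector_bounded[OF assms(1) \<eta>(3) _ \<eta>(2) assms(2) smaller D that])
      simp_all
  ultimately show "\<exists>C>0. \<forall>f\<in>L1_loc. campanato_norm_X X N \<phi> f \<le> ennreal C * campanato_norm \<phi> f"
    by blast
qed

end
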